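(* Let $n\geq 4$, let $G_n=\mathbb{Z}_n\times\mathbb{Z}_n$, let $S=\{(i,0),(0,i),(i,i): 1\leq i\leq n-1\}\subset G_n$, and let $\Gamma(n)=\mathrm{Cay}(G_n;S)$ be the Cayley graph with vertex set $G_n$ in which $g\sim h$ iff $h-g\in S$. Then $$\mathrm{Aut}(\Gamma(n))\cong (\mathbb{Z}_n\times\mathbb{Z}_n)\rtimes(\mathbb{Z}_n^*\times \mathrm{Sym}(3)).$$
   Context: $\mathbb{Z}_n^*$ denotes the group of units of the ring $\mathbb{Z}_n$, and $\mathrm{Sym}(3)$ the symmetric group on 3 letters. *)

theory Defs
  imports "HOL-Algebra.Algebra" "HOL-Number_Theory.Residues" "Graph_Theory.Pair_Digraph"
begin

definition cayley_graph :: "('a, 'b) monoid_scheme \<Rightarrow> 'a set \<Rightarrow> 'a pair_pre_digraph" where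
  "cayley_graph G S =
     \<lparr>pverts = carrier G,
      parcs = {(g, h). g \<in> carrier G \<and> h \<in> carrier G \<and> h \<otimes>\<^bsub>G\<^esub> inv\<^bsub>G\<^esub> g \<in> S}\<rparr>"

definition graph_auts :: "'a pair_pre_digraph \<Rightarrow> ('a \<Rightarrow> 'a) set" where
  "graph_auts \<Gamma> = {f \<in> Bij (pverts \<Gamma>).
     \<forall>x\<in>pverts \<Gamma>. \<forall>y\<in>pverts \<Gamma>. (x, y) \<in> parcs \<Gamma> \<longleftrightarrow> (f x, f y) \<in> parcs \<Gamma>}"

definition graph_aut_group :: "'a pair_pre_digraph \<Rightarrow> ('a \<Rightarrow> 'a) monoid" where
  "graph_aut_group \<Gamma> = BijGroup (pverts \<Gamma>) \<lparr>carrier := graph_auts \<Gamma>\<rparr>"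

text \<open>The semidirect product of \<open>N\<close> by \<open>H\<close> along \<open>\<phi> \<in> hom H (AutoGroup N)\<close>.\<close>

definition semidirect_product ::
  "('a, 'b) monoid_scheme \<Rightarrow> ('c, 'd) monoid_scheme \<Rightarrow> ('c \<Rightarrow> 'a \<Rightarrow> 'a) \<Rightarrow> ('a \<times> 'c) monoid" where
  "semidirect_product N H \<phi> =
     \<lparr>carrier = carrier N \<times> carrier H,
      monoid.mult = (\<lambda>(a, h) (b, k). (a \<otimes>\<^bsub>N\<^esub> \<phi> h b, h \<otimes>\<^bsub>H\<^esub> k)),
      one = (\<one>\<^bsub>N\<^esub>, \<one>\<^bsub>H\<^esub>)\<rparr>"

definition Zn_sq :: "nat \<Rightarrow> (int \<times> int) monoid" where
  "Zn_sq n = integer_mod_group n \<times>\<times> integer_mod_group n"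

definition conn_set :: "nat \<Rightarrow> (int \<times> int) set" where
  "conn_set n = (\<Union>i\<in>{1..int n - 1}. {(i, 0), (0, i), (i, i)})"

definition Gamma :: "nat \<Rightarrow> (int \<times> int) pair_pre_digraph" where
  "Gamma n = cayley_graph (Zn_sq n) (conn_set n)"

text \<open>
  Generators of the three cyclic subgroups \<open>\<langle>(1,0)\<rangle>\<close>, \<open>\<langle>(0,1)\<rangle>\<close>, \<open>\<langle>(1,1)\<rangle>\<close> whose nonzero elements
  make up the connection set. The sign of the third one makes the three vectors sum to zero, so
  that every permutation of them extends to an automorphism of the group.
\<close>

definition gen :: "nat \<Rightarrow> int \<times> int" where
  "gen i = (if i = 1 then (1, 0) else if i = 2 then (0, 1) else (-1, -1))"

text \<open>
  The pair \<open>(u, \<sigma>)\<close> acts as scalar multiplication by \<open>u\<close> composed with the automorphism that sends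
  \<open>gen i\<close> to \<open>gen (\<sigma> i)\<close> for \<open>i = 1, 2, 3\<close>.
\<close>

definition unit_sym_action :: "nat \<Rightarrow> int \<times> (nat \<Rightarrow> nat) \<Rightarrow> int \<times> int \<Rightarrow> int \<times> int" where
  "unit_sym_action n = (\<lambda>(u, \<sigma>). restrict
     (\<lambda>(x, y). (u * (x * fst (gen (\<sigma> 1)) + y * fst (gen (\<sigma> 2))) mod int n,
                u * (x * snd (gen (\<sigma> 1)) + y * snd (gen (\<sigma> 2))) mod int n))
     (carrier (Zn_sq n)))"

definition unit_sym_group :: "nat \<Rightarrow> (int \<times> (nat \<Rightarrow> nat)) monoid" where
  "unit_sym_group n = units_of (residue_ring (int n)) \<times>\<times> sym_group 3"

lemma Zn_sq_simps:
  assumes "n > 0"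
  shows "carrier (Zn_sq n) = {0..<int n} \<times> {0..<int n}"
    and "(a, b) \<otimes>\<^bsub>Zn_sq n\<^esub> (c, d) = ((a + c) mod int n, (b + d) mod int n)"
    and "\<one>\<^bsub>Zn_sq n\<^esub> = (0, 0)"
  using assms by (auto simp: Zn_sq_def DirProd_def carrier_integer_mod_group)

lemma group_Zn_sq: "group (Zn_sq n)"
  unfolding Zn_sq_def by (intro DirProd_group group_integer_mod_group)

lemma inv_Zn_sq:
  assumes "(a, b) \<in> carrier (Zn_sq n)"
  shows "inv\<^bsub>Zn_sq n\<^esub> (a, b) = ((- a) mod int n, (- b) mod int n)"
proof -
  have "a \<in> carrier (integer_mod_group n)" "b \<in> carrier (integer_mod_group n)"
    using assms by (simp_all add: Zn_sq_def)
  then show ?thesis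
    using inv_DirProd[OF group_integer_mod_group group_integer_mod_group] by (simp add: Zn_sq_def)
qed

lemma conn_set_iff:
  "(a, b) \<in> conn_set n \<longleftrightarrow>
    (a \<in> {1..int n - 1} \<and> b = 0) \<or> (a = 0 \<and> b \<in> {1..int n - 1}) \<or> (a \<in> {1..int n - 1} \<and> a = b)"
  by (auto simp: conn_set_def)

lemma Gamma_arc_iff:
  assumes "n > 0"
  shows "((a, b), (c, d)) \<in> parcs (Gamma n) \<longleftrightarrow>
     a \<in> {0..<int n} \<and> b \<in> {0..<int n} \<and> c \<in> {0..<int n} \<and> d \<in> {0..<int n} \<and>
     ((c - a) mod int n, (d - b) mod int n) \<in> conn_set n"
proof -
  have "(c + - a mod int n) mod int n = (c - a) mod int n"
       "(d + - b mod int n) mod int n = (d - b) mod int n"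
    by (simp_all add: mod_add_right_eq)
  then show ?thesis
    using assms inv_Zn_sq[of a b n]
    by (auto simp: Gamma_def cayley_graph_def Zn_sq_simps)
qed

lemma mod_neg_swap:
  fixes c a :: int assumes "n > 0"
  shows "(a - c) mod n = (if (c - a) mod n = 0 then 0 else n - (c - a) mod n)"
  using zmod_zminus1_eq_if[of "c - a" n] by simp

text \<open>\<open>Gamma n\<close> is a finite simple undirected graph.\<close>

lemma pair_graph_Gamma:
  assumes "n > 0"
  shows "pair_graph (Gamma n)"
proof
  have v: "pverts (Gamma n) = {0..<int n} \<times> {0..<int n}"
    using assms by (simp add: Gamma_def cayley_graph_def Zn_sq_simps)
  have sub: "parcs (Gamma n) \<subseteq> pverts (Gamma n) \<times> pverts (Gamma n)"
    by (auto simp: Gamma_def cayley_graph_def)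
  show "finite (pverts (Gamma n))" by (simp add: v)
  then show "finite (parcs (Gamma n))"
    using sub finite_subset by blast
  fix e
  show "e \<in> parcs (Gamma n) \<Longrightarrow> fst e \<in> pverts (Gamma n)"
    and "e \<in> parcs (Gamma n) \<Longrightarrow> snd e \<in> pverts (Gamma n)"
    using sub by auto
  show "e \<in> parcs (Gamma n) \<Longrightarrow> fst e \<noteq> snd e"
    using assms by (cases e) (auto simp: Gamma_arc_iff conn_set_iff)
next
  have swap: "(if p = 0 then 0 else int n - p, if q = 0 then 0 else int n - q) \<in> conn_set n"
    if "(p, q) \<in> conn_set n" for p q
    using that unfolding conn_set_iff by (elim disjE) simp_all
  have "((c, d), (a, b)) \<in> parcs (Gamma n)" if "((a, b), (c, d)) \<in> parcs (Gamma n)" for a b c d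
  proof -
    have "0 < int n" using assms by simp
    note eq = mod_neg_swap[OF this, of a c] mod_neg_swap[OF this, of b d]
    show ?thesis
      using that swap[of "(c - a) mod int n" "(d - b) mod int n"]
      unfolding Gamma_arc_iff[OF assms] eq by blast
  qed
  then show "symmetric (with_proj (Gamma n))"
    by (auto simp: symmetric_def sym_def)
qed

lemma group_graph_aut_group: "group (graph_aut_group \<Gamma>)"
proof -
  interpret group "BijGroup (pverts \<Gamma>)" by (rule group_BijGroup)
  have "subgroup (graph_auts \<Gamma>) (BijGroup (pverts \<Gamma>))"
  proof (rule subgroupI)
    show "graph_auts \<Gamma> \<subseteq> carrier (BijGroup (pverts \<Gamma>))"
      by (auto simp: graph_auts_def BijGroup_def)
    have "(\<lambda>x\<in>pverts \<Gamma>. x) \<in> graph_auts \<Gamma>"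
      by (auto simp: graph_auts_def id_Bij)
    then show "graph_auts \<Gamma> \<noteq> {}" by blast
  next
    fix f assume f: "f \<in> graph_auts \<Gamma>"
    then have fB: "f \<in> Bij (pverts \<Gamma>)" by (simp add: graph_auts_def)
    have eq: "inv\<^bsub>BijGroup (pverts \<Gamma>)\<^esub> f = (\<lambda>x\<in>pverts \<Gamma>. inv_into (pverts \<Gamma>) f x)"
      by (rule inv_BijGroup[OF fB])
    have im: "f ` pverts \<Gamma> = pverts \<Gamma>" using fB by (auto simp: Bij_def bij_betw_def)
    have "(x, y) \<in> parcs \<Gamma> \<longleftrightarrow> (inv_into (pverts \<Gamma>) f x, inv_into (pverts \<Gamma>) f y) \<in> parcs \<Gamma>"
      if "x \<in> pverts \<Gamma>" "y \<in> pverts \<Gamma>" for x y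
    proof -
      have "inv_into (pverts \<Gamma>) f x \<in> pverts \<Gamma>" "inv_into (pverts \<Gamma>) f y \<in> pverts \<Gamma>"
        "f (inv_into (pverts \<Gamma>) f x) = x" "f (inv_into (pverts \<Gamma>) f y) = y"
        using that im by (auto intro: inv_into_into f_inv_into_f)
      moreover have "(a, b) \<in> parcs \<Gamma> \<longleftrightarrow> (f a, f b) \<in> parcs \<Gamma>"
        if "a \<in> pverts \<Gamma>" "b \<in> pverts \<Gamma>" for a b
        using f that by (simp add: graph_auts_def)
      ultimately show ?thesis by metis
    qed
    then show "inv\<^bsub>BijGroup (pverts \<Gamma>)\<^esub> f \<in> graph_auts \<Gamma>"
      using restrict_inv_into_Bij[OF fB] by (simp add: eq graph_auts_def)
  next
    fix f g assume fg: "f \<in> graph_auts \<Gamma>" "g \<in> graph_auts \<Gamma>"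
    then have B: "f \<in> Bij (pverts \<Gamma>)" "g \<in> Bij (pverts \<Gamma>)" by (simp_all add: graph_auts_def)
    have "(x, y) \<in> parcs \<Gamma> \<longleftrightarrow> (f (g x), f (g y)) \<in> parcs \<Gamma>"
      if xy: "x \<in> pverts \<Gamma>" "y \<in> pverts \<Gamma>" for x y
    proof -
      have "g x \<in> pverts \<Gamma>" "g y \<in> pverts \<Gamma>"
        using xy Bij_imp_funcset[OF B(2)] by auto
      then have "(g x, g y) \<in> parcs \<Gamma> \<longleftrightarrow> (f (g x), f (g y)) \<in> parcs \<Gamma>"
        using fg(1) by (simp add: graph_auts_def)
      moreover have "(x, y) \<in> parcs \<Gamma> \<longleftrightarrow> (g x, g y) \<in> parcs \<Gamma>"
        using fg(2) xy unfolding graph_auts_def by blast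
      ultimately show ?thesis by simp
    qed
    then show "f \<otimes>\<^bsub>BijGroup (pverts \<Gamma>)\<^esub> g \<in> graph_auts \<Gamma>"
      using B by (simp add: graph_auts_def BijGroup_def compose_Bij compose_eq)
  qed
  then show ?thesis
    unfolding graph_aut_group_def by (rule subgroup_imp_group)
qed

lemma group_semidirect_product:
  assumes N: "group N" and H: "group H" and \<phi>: "\<phi> \<in> hom H (AutoGroup N)"
  shows "group (semidirect_product N H \<phi>)"
proof -
  interpret N: group N by fact
  interpret H: group H by fact
  interpret A: group "AutoGroup N" by (rule N.AutoGroup)
  have in_auto: "\<phi> h \<in> auto N" if "h \<in> carrier H" for h
    using \<phi> that by (auto simp: hom_def AutoGroup_def)
  have cl: "\<phi> h a \<in> carrier N" if "h \<in> carrier H" "a \<in> carrier N" for h a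
    using in_auto[OF that(1)] that(2) by (auto simp: auto_def hom_def)
  have mu: "\<phi> h (a \<otimes>\<^bsub>N\<^esub> b) = \<phi> h a \<otimes>\<^bsub>N\<^esub> \<phi> h b"
    if "h \<in> carrier H" "a \<in> carrier N" "b \<in> carrier N" for h a b
    using in_auto[OF that(1)] that by (auto simp: auto_def hom_def)
  have co: "\<phi> (h \<otimes>\<^bsub>H\<^esub> k) a = \<phi> h (\<phi> k a)"
    if "h \<in> carrier H" "k \<in> carrier H" "a \<in> carrier N" for h k a
  proof -
    have "\<phi> (h \<otimes>\<^bsub>H\<^esub> k) = \<phi> h \<otimes>\<^bsub>AutoGroup N\<^esub> \<phi> k"
      using \<phi> that by (simp add: hom_def)
    then show ?thesis
      using in_auto[OF that(1)] in_auto[OF that(2)] that(3)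
      by (simp add: AutoGroup_def BijGroup_def auto_def compose_def)
  qed
  have "group_hom H (AutoGroup N) \<phi>"
    by (simp add: group_hom_def group_hom_axioms_def \<phi> H A.is_group)
  then have "\<phi> \<one>\<^bsub>H\<^esub> = \<one>\<^bsub>AutoGroup N\<^esub>" by (rule group_hom.hom_one)
  then have on: "\<phi> \<one>\<^bsub>H\<^esub> a = a" if "a \<in> carrier N" for a
    using that by (simp add: AutoGroup_def BijGroup_def)
  let ?P = "semidirect_product N H \<phi>"
  have carr: "carrier ?P = carrier N \<times> carrier H" and unit: "\<one>\<^bsub>?P\<^esub> = (\<one>\<^bsub>N\<^esub>, \<one>\<^bsub>H\<^esub>)"
    by (simp_all add: semidirect_product_def)
  have mult: "(a, h) \<otimes>\<^bsub>?P\<^esub> (b, k) = (a \<otimes>\<^bsub>N\<^esub> \<phi> h b, h \<otimes>\<^bsub>H\<^esub> k)" for a h b k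
    by (simp add: semidirect_product_def)
  show ?thesis
  proof (rule groupI)
    fix x y assume "x \<in> carrier ?P" "y \<in> carrier ?P"
    then obtain a h b k where "x = (a, h)" "y = (b, k)"
      "a \<in> carrier N" "h \<in> carrier H" "b \<in> carrier N" "k \<in> carrier H"
      unfolding carr by (elim SigmaE)
    then show "x \<otimes>\<^bsub>?P\<^esub> y \<in> carrier ?P" by (simp add: carr mult cl)
  next
    fix x y z assume "x \<in> carrier ?P" "y \<in> carrier ?P" "z \<in> carrier ?P"
    then obtain a h b k c l where "x = (a, h)" "y = (b, k)" "z = (c, l)"
      "a \<in> carrier N" "h \<in> carrier H" "b \<in> carrier N" "k \<in> carrier H" "c \<in> carrier N" "l \<in> carrier H"
      unfolding carr by (elim SigmaE)
    then show "x \<otimes>\<^bsub>?P\<^esub> y \<otimes>\<^bsub>?P\<^esub> z = x \<otimes>\<^bsub>?P\<^esub> (y \<otimes>\<^bsub>?P\<^esub> z)"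
      by (simp add: mult cl mu co N.m_assoc H.m_assoc)
  next
    show "\<one>\<^bsub>?P\<^esub> \<in> carrier ?P" by (simp add: carr unit)
  next
    fix x assume "x \<in> carrier ?P"
    then obtain a h where x: "x = (a, h)" "a \<in> carrier N" "h \<in> carrier H"
      unfolding carr by (elim SigmaE)
    then show "\<one>\<^bsub>?P\<^esub> \<otimes>\<^bsub>?P\<^esub> x = x" by (simp add: unit mult on)
    let ?y = "(\<phi> (inv\<^bsub>H\<^esub> h) (inv\<^bsub>N\<^esub> a), inv\<^bsub>H\<^esub> h)"
    have "\<phi> (inv\<^bsub>H\<^esub> h) (inv\<^bsub>N\<^esub> a) \<otimes>\<^bsub>N\<^esub> \<phi> (inv\<^bsub>H\<^esub> h) a = \<phi> (inv\<^bsub>H\<^esub> h) \<one>\<^bsub>N\<^esub>"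
      using x mu[of "inv\<^bsub>H\<^esub> h" "inv\<^bsub>N\<^esub> a" a] by simp
    also have "\<dots> = \<one>\<^bsub>N\<^esub>"
      using mu[of "inv\<^bsub>H\<^esub> h" "\<one>\<^bsub>N\<^esub>" "\<one>\<^bsub>N\<^esub>"] cl[of "inv\<^bsub>H\<^esub> h" "\<one>\<^bsub>N\<^esub>"] x N.r_cancel_one' by simp
    finally have "?y \<otimes>\<^bsub>?P\<^esub> x = \<one>\<^bsub>?P\<^esub>" "?y \<in> carrier ?P"
      using x by (simp_all add: unit mult carr cl)
    then show "\<exists>y\<in>carrier ?P. y \<otimes>\<^bsub>?P\<^esub> x = \<one>\<^bsub>?P\<^esub>" by blast
  qed
qed

lemma gen_sum:
  assumes "\<sigma> permutes {1..3::nat}"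
  shows "fst (gen (\<sigma> 1)) + fst (gen (\<sigma> 2)) + fst (gen (\<sigma> 3)) = 0"
    and "snd (gen (\<sigma> 1)) + snd (gen (\<sigma> 2)) + snd (gen (\<sigma> 3)) = 0"
proof -
  have s: "(\<Sum>i\<in>{1..3}. f (\<sigma> i)) = (\<Sum>i\<in>{1..3}. f i)" for f :: "nat \<Rightarrow> int"
    using sum.permute[OF assms, of f] by (simp add: o_def)
  have e: "{1..3::nat} = {1, 2, 3}" by auto
  show "fst (gen (\<sigma> 1)) + fst (gen (\<sigma> 2)) + fst (gen (\<sigma> 3)) = 0"
    using s[of "\<lambda>i. fst (gen i)"] unfolding e by (simp add: gen_def)
  show "snd (gen (\<sigma> 1)) + snd (gen (\<sigma> 2)) + snd (gen (\<sigma> 3)) = 0"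
    using s[of "\<lambda>i. snd (gen i)"] unfolding e by (simp add: gen_def)
qed

lemma gen_lin:
  assumes "\<sigma> permutes {1..3::nat}" "i \<in> {1..3}"
  shows "fst (gen i) * fst (gen (\<sigma> 1)) + snd (gen i) * fst (gen (\<sigma> 2)) = fst (gen (\<sigma> i))"
    and "fst (gen i) * snd (gen (\<sigma> 1)) + snd (gen i) * snd (gen (\<sigma> 2)) = snd (gen (\<sigma> i))"
proof -
  consider "i = 1" | "i = 2" | "i = 3" using assms(2) by force
  then have "fst (gen i) * fst (gen (\<sigma> 1)) + snd (gen i) * fst (gen (\<sigma> 2)) = fst (gen (\<sigma> i)) \<and>
    fst (gen i) * snd (gen (\<sigma> 1)) + snd (gen i) * snd (gen (\<sigma> 2)) = snd (gen (\<sigma> i))"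
  proof cases
    case 1
    then have "gen i = (1, 0)" by (simp add: gen_def)
    with 1 show ?thesis by simp
  next
    case 2
    then have "gen i = (0, 1)" by (simp add: gen_def)
    with 2 show ?thesis by simp
  next
    case 3
    then have "gen i = (-1, -1)" by (simp add: gen_def)
    then have "fst (gen i) = -1" "snd (gen i) = -1" by simp_all
    then show ?thesis using gen_sum[OF assms(1)] by (simp add: 3)
  qed
  then show "fst (gen i) * fst (gen (\<sigma> 1)) + snd (gen i) * fst (gen (\<sigma> 2)) = fst (gen (\<sigma> i))"
    and "fst (gen i) * snd (gen (\<sigma> 1)) + snd (gen i) * snd (gen (\<sigma> 2)) = snd (gen (\<sigma> i))"
    by auto
qed

lemma group_unit_sym_group:
  assumes "n > 1"
  shows "group (unit_sym_group n)"
proof -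
  interpret residues "int n" "residue_ring (int n)"
    using assms by unfold_locales auto
  show ?thesis
    unfolding unit_sym_group_def
    by (intro DirProd_group units_group sym_group_is_group)
qed

lemma unit_sym_group_simps:
  assumes "n > 1"
  shows "carrier (unit_sym_group n) =
           {u. 0 < u \<and> u < int n \<and> coprime u (int n)} \<times> {\<sigma>. \<sigma> permutes {1..3}}"
    and "(u, \<sigma>) \<otimes>\<^bsub>unit_sym_group n\<^esub> (v, \<tau>) = ((u * v) mod int n, \<sigma> \<circ> \<tau>)"
    and "\<one>\<^bsub>unit_sym_group n\<^esub> = (1, id)"
proof -
  interpret residues "int n" "residue_ring (int n)"
    using assms by unfold_locales auto
  show "carrier (unit_sym_group n) =
           {u. 0 < u \<and> u < int n \<and> coprime u (int n)} \<times> {\<sigma>. \<sigma> permutes {1..3}}"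
    by (simp add: unit_sym_group_def DirProd_def units_of_def res_units_eq sym_group_def)
  show "(u, \<sigma>) \<otimes>\<^bsub>unit_sym_group n\<^esub> (v, \<tau>) = ((u * v) mod int n, \<sigma> \<circ> \<tau>)"
    and "\<one>\<^bsub>unit_sym_group n\<^esub> = (1, id)"
    by (simp_all add: unit_sym_group_def DirProd_def units_of_def sym_group_def res_mult_eq res_one_eq)
qed

lemma mod_lin2:
  fixes u p q A B m :: int
  shows "u * ((p mod m) * A + (q mod m) * B) mod m = u * (p * A + q * B) mod m"
  by (intro mod_mult_cong mod_add_cong refl) simp_all

lemma unit_sym_action_apply:
  assumes "(x, y) \<in> carrier (Zn_sq n)"
  shows "unit_sym_action n (u, \<sigma>) (x, y) =
     (u * (x * fst (gen (\<sigma> 1)) + y * fst (gen (\<sigma> 2))) mod int n,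
      u * (x * snd (gen (\<sigma> 1)) + y * snd (gen (\<sigma> 2))) mod int n)"
  using assms by (simp add: unit_sym_action_def)

lemma unit_sym_action_comp:
  assumes n: "n > 1" and \<sigma>: "\<sigma> permutes {1..3}" and \<tau>: "\<tau> permutes {1..3}"
    and z: "z \<in> carrier (Zn_sq n)"
  shows "unit_sym_action n (u, \<sigma>) (unit_sym_action n (v, \<tau>) z) =
         unit_sym_action n ((u * v) mod int n, \<sigma> \<circ> \<tau>) z"
proof -
  obtain x y where xy: "z = (x, y)" by (cases z)
  let ?v = "unit_sym_action n (v, \<tau>) z"
  have vc: "?v \<in> carrier (Zn_sq n)"
    using z n by (simp add: xy unit_sym_action_apply Zn_sq_simps)
  have t: "\<tau> 1 \<in> {1..3}" "\<tau> 2 \<in> {1..3}"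
    using permutes_in_image[OF \<tau>, of 1] permutes_in_image[OF \<tau>, of 2] by simp_all
  note g = gen_lin[OF \<sigma> t(1)] gen_lin[OF \<sigma> t(2)]
  have key: "u * (v * (x * p1 + y * p2) mod int n * A + v * (x * q1 + y * q2) mod int n * B) mod int n
      = (u * v mod int n) * (x * (p1 * A + q1 * B) + y * (p2 * A + q2 * B)) mod int n"
    for p1 p2 q1 q2 A B
    unfolding mod_lin2 mod_mult_left_eq by (simp add: algebra_simps)
  show ?thesis
    unfolding xy unit_sym_action_apply[OF z[unfolded xy]]
      unit_sym_action_apply[OF vc[unfolded xy unit_sym_action_apply[OF z[unfolded xy]]]]
      key g o_def ..
qed

text \<open>The action is by group automorphisms, so the semidirect product is a group.\<close>

lemma unit_sym_action_hom:
  assumes n: "n > 1"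
  shows "unit_sym_action n \<in> hom (unit_sym_group n) (AutoGroup (Zn_sq n))"
proof -
  let ?C = "carrier (Zn_sq n)" and ?H = "unit_sym_group n" and ?a = "unit_sym_action n"
  interpret H: group ?H by (rule group_unit_sym_group[OF n])
  have cl: "?a h z \<in> ?C" if "z \<in> ?C" for h z
    using that n by (cases z; cases h) (simp add: unit_sym_action_apply Zn_sq_simps)
  have comp: "?a h (?a k z) = ?a (h \<otimes>\<^bsub>?H\<^esub> k) z"
    if "h \<in> carrier ?H" "k \<in> carrier ?H" "z \<in> ?C" for h k z
    using that n by (cases h; cases k) (auto simp: unit_sym_group_simps unit_sym_action_comp)
  have one: "?a \<one>\<^bsub>?H\<^esub> z = z" if "z \<in> ?C" for z
    using that n by (cases z) (auto simp: unit_sym_group_simps unit_sym_action_apply gen_def Zn_sq_simps)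
  have bij: "?a h \<in> Bij ?C" if h: "h \<in> carrier ?H" for h
  proof -
    have "bij_betw (?a h) ?C ?C"
      using h comp[of h "inv\<^bsub>?H\<^esub> h"] comp[of "inv\<^bsub>?H\<^esub> h" h] one cl
      by (intro bij_betwI[where g = "?a (inv\<^bsub>?H\<^esub> h)"]) auto
    moreover have "?a h \<in> extensional ?C"
      by (cases h) (simp add: unit_sym_action_def)
    ultimately show ?thesis by (simp add: Bij_def)
  qed
  have add: "?a h (z \<otimes>\<^bsub>Zn_sq n\<^esub> w) = ?a h z \<otimes>\<^bsub>Zn_sq n\<^esub> ?a h w"
    if "z \<in> ?C" "w \<in> ?C" for h z w
  proof -
    obtain x y x' y' u \<sigma> where e: "z = (x, y)" "w = (x', y')" "h = (u, \<sigma>)"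
      by (cases z; cases w; cases h)
    have m: "z \<otimes>\<^bsub>Zn_sq n\<^esub> w \<in> ?C"
      using that by (intro group.subgroup_self[OF group_Zn_sq, THEN subgroup.m_closed])
    have zw: "z \<otimes>\<^bsub>Zn_sq n\<^esub> w = ((x + x') mod int n, (y + y') mod int n)"
      using n by (simp add: e Zn_sq_simps)
    have k: "u * ((x + x') mod int n * A + (y + y') mod int n * B) mod int n =
        (u * (x * A + y * B) mod int n + u * (x' * A + y' * B) mod int n) mod int n" for A B
      unfolding mod_lin2 mod_add_eq by (simp add: algebra_simps)
    show ?thesis
      unfolding zw e(3) unit_sym_action_apply[OF m[unfolded zw]]
      using that n by (simp add: e unit_sym_action_apply Zn_sq_simps(2) k)
  qed
  have auto: "?a h \<in> auto (Zn_sq n)" if "h \<in> carrier ?H" for h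
    using bij[OF that] cl add by (auto simp: auto_def hom_def)
  show ?thesis
  proof (rule homI)
    fix h k assume hk: "h \<in> carrier ?H" "k \<in> carrier ?H"
    have "?a (h \<otimes>\<^bsub>?H\<^esub> k) = compose ?C (?a h) (?a k)"
    proof (rule extensionalityI[where A = ?C])
      show "?a (h \<otimes>\<^bsub>?H\<^esub> k) \<in> extensional ?C"
        using bij[of "h \<otimes>\<^bsub>?H\<^esub> k"] hk by (simp add: Bij_def)
    next
      show "compose ?C (?a h) (?a k) \<in> extensional ?C" by simp
    next
      fix z assume "z \<in> ?C"
      then show "?a (h \<otimes>\<^bsub>?H\<^esub> k) z = compose ?C (?a h) (?a k) z"
        using comp[OF hk] by (simp only: compose_eq)
    qed
    then show "?a (h \<otimes>\<^bsub>?H\<^esub> k) = ?a h \<otimes>\<^bsub>AutoGroup (Zn_sq n)\<^esub> ?a k"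
      using bij hk by (simp add: AutoGroup_def BijGroup_def)
  qed (simp add: AutoGroup_def auto)
qed

end

(* The three families of lines (cosets of the cyclic subgroups generated by gen 1, gen 2, gen 3) are
   the level sets of three linear forms coord 1, coord 2, coord 3 that sum to zero, and two vertices
   are adjacent iff exactly one of these forms agrees on them. Collinearity of a triangle is
   definable from adjacency, so an automorphism f maps the lines through each vertex v to the lines
   through f v and induces a permutation of the three directions. Along an edge, the non-collinear
   triangles containing it force the permutations at its two ends to agree; as the graph is
   connected, there is one permutation s with coord (s k) (f p) = g k (coord k p) for all p. The
   functions g k satisfy g 1 a + g 2 b + g 3 c = 0 whenever a + b + c = 0, hence are affine with a
   common slope u, which is a unit by surjectivity. So f is a translation composed with the action
   of (u, s) up to sign, and these maps form the semidirect product. *)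
theory Submission
  imports Defs
begin

section \<open>Linear forms and congruences\<close>

lemma other_index:
  obtains l :: nat where "l \<in> {1..3}" "k \<noteq> l"
proof -
  have "(if k = 1 then 2 else 1) \<in> {1..3::nat}" "k \<noteq> (if k = 1 then 2 else 1)" by auto
  then show ?thesis by (rule that)
qed

lemma triangle_indices:
  assumes "k \<in> {1..3}" "l \<in> {1..3}" "k \<noteq> l"
  obtains m :: nat where "m \<in> {1..3}" "m \<noteq> k" "m \<noteq> l" "{k, l, m} = {1..3}"
proof -
  have e: "{1..3::nat} = {1, 2, 3}" by auto
  have "6 - k - l \<in> {1..3}" "6 - k - l \<noteq> k" "6 - k - l \<noteq> l" "{k, l, 6 - k - l} = {1..3}"
    using assms unfolding e by auto
  then show ?thesis by (rule that)
qed

text \<open>\<open>coord k\<close> vanishes on \<open>gen k\<close>, so its level sets modulo \<open>n\<close> are the lines of direction \<open>gen k\<close>. The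
  signs make the three forms sum to zero, in parallel with the vectors \<open>gen k\<close>.\<close>

definition coord :: "nat \<Rightarrow> int \<times> int \<Rightarrow> int" where
  "coord k p = (if k = 1 then snd p else if k = 2 then - fst p else fst p - snd p)"

lemma coord_sum:
  assumes "{k, l, m} = {1..3::nat}"
  shows "coord k p + coord l p + coord m p = 0"
proof -
  have e: "{1..3::nat} = {1, 2, 3}" by auto
  have "card {k, l, m} = 3" by (simp add: assms)
  then have "k \<noteq> l" "k \<noteq> m" "l \<noteq> m" by (auto simp: card_insert_if split: if_splits)
  moreover have "k \<in> {1,2,3}" "l \<in> {1,2,3}" "m \<in> {1,2,3}"
    using assms e by (metis insertCI)+
  ultimately show ?thesis by (auto simp: coord_def)
qed

definition par :: "nat \<Rightarrow> nat \<Rightarrow> int \<times> int \<Rightarrow> int \<times> int \<Rightarrow> bool" where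
  "par n k p q \<longleftrightarrow> [coord k p = coord k q] (mod int n)"

lemma par_refl [simp]: "par n k p p"
  by (simp add: par_def)

lemma par_sym: "par n k p q \<Longrightarrow> par n k q p"
  by (simp add: par_def cong_sym)

lemma par_trans: "par n k p q \<Longrightarrow> par n k q r \<Longrightarrow> par n k p r"
  unfolding par_def by (rule cong_trans)

lemma cong_zero_sum:
  fixes a b c :: int
  assumes "a + b + c = 0" "a' + b' + c' = 0" "[a = a'] (mod N)" "[b = b'] (mod N)"
  shows "[c = c'] (mod N)"
proof -
  have "c - c' = - ((a - a') + (b - b'))" using assms(1,2) by simp
  then show ?thesis
    using assms(3,4) unfolding cong_iff_dvd_diff by (metis dvd_add dvd_minus_iff)
qed

lemma par_third:
  assumes "{k, l, m} = {1..3}" "par n k p q" "par n l p q"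
  shows "par n m p q"
  using cong_zero_sum[OF coord_sum[OF assms(1)] coord_sum[OF assms(1)]] assms(2,3)
  unfolding par_def by blast

text \<open>A cyclic group has at most one element of order two, and \<open>x\<close> and
  \<open>y\<close> both represent it: in \<open>2 * x = N * a\<close> and
  \<open>2 * y = N * b\<close> the cofactors are odd, so they differ by an even number. This rules
  out two different differences of order two along one line.\<close>

lemma cong_double_zero:
  fixes x y N :: int
  assumes "N dvd 2 * x" "N dvd 2 * y" "\<not> N dvd x" "\<not> N dvd y"
  shows "N dvd x - y"
proof -
  obtain a b where ab: "2 * x = N * a" "2 * y = N * b" using assms(1,2) by (auto simp: dvd_def)
  have "odd a" "odd b"
    using ab assms(3,4) by (auto elim!: evenE)
  then have "even (a - b)" by simp
  then obtain c where c: "a - b = 2 * c" by (elim evenE)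
  have "2 * (x - y) = N * (a - b)" using ab by (simp add: right_diff_distrib)
  then have "x - y = N * c" unfolding c by simp
  then show ?thesis by simp
qed

lemma arithmetic_progression_dvd:
  fixes g :: "int \<Rightarrow> int"
  assumes "\<And>a. N dvd g (a + 1) - g a - u"
  shows "N dvd g a - g 0 - u * a"
proof (induction a rule: int_induct[where k = 0])
  case base
  show ?case by simp
next
  case (step1 i)
  have "g (i + 1) - g 0 - u * (i + 1) = (g i - g 0 - u * i) + (g (i + 1) - g i - u)"
    by (simp add: algebra_simps)
  then show ?case using step1 assms by (metis dvd_add)
next
  case (step2 i)
  have "g (i - 1) - g 0 - u * (i - 1) = (g i - g 0 - u * i) - (g (i - 1 + 1) - g (i - 1) - u)"
    by (simp add: algebra_simps)
  then show ?case using step2 assms by (metis dvd_diff)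
qed

text \<open>The relation at \<open>(a + 1, b)\<close> and \<open>(a, b + 1)\<close> shows that the increments of \<open>g 1\<close> at \<open>a\<close> and of
  \<open>g 2\<close> at \<open>b\<close> agree, so both are constant.\<close>

lemma zero_sum_imp_affine:
  fixes g :: "nat \<Rightarrow> int \<Rightarrow> int"
  assumes sum: "\<And>a b c. a + b + c = 0 \<Longrightarrow> N dvd g 1 a + g 2 b + g 3 c"
  obtains u where "\<And>k a. k \<in> {1..3} \<Longrightarrow> N dvd g k a - g k 0 - u * a"
proof -
  define u where "u = g 1 1 - g 1 0"
  have inc: "N dvd (g 1 (a + 1) - g 1 a) - (g 2 (b + 1) - g 2 b)" for a b
  proof -
    have "N dvd (g 1 (a + 1) + g 2 b + g 3 (- a - b - 1)) - (g 1 a + g 2 (b + 1) + g 3 (- a - b - 1))"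
      by (intro dvd_diff sum) simp_all
    then show ?thesis by (simp add: algebra_simps)
  qed
  have inc2: "N dvd g 2 (b + 1) - g 2 b - u" for b
  proof -
    have "N dvd - (g 1 (0 + 1) - g 1 0 - (g 2 (b + 1) - g 2 b))"
      using inc[of 0 b] by (simp only: dvd_minus_iff)
    then show ?thesis by (simp add: u_def algebra_simps)
  qed
  have inc1: "N dvd g 1 (a + 1) - g 1 a - u" for a
  proof -
    have "N dvd (g 1 (a + 1) - g 1 a - (g 2 (0 + 1) - g 2 0)) + (g 2 (0 + 1) - g 2 0 - u)"
      using inc inc2 by (rule dvd_add)
    then show ?thesis by (simp add: algebra_simps)
  qed
  have 1: "N dvd g 1 a - g 1 0 - u * a" for a
    using inc1 by (rule arithmetic_progression_dvd)
  have 2: "N dvd g 2 a - g 2 0 - u * a" for a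
    using inc2 by (rule arithmetic_progression_dvd)
  have 3: "N dvd g 3 c - g 3 0 - u * c" for c
  proof -
    have "N dvd (g 1 (- c) + g 2 0 + g 3 c) - (g 1 0 + g 2 0 + g 3 0) - (g 1 (- c) - g 1 0 - u * - c)"
      by (intro dvd_diff sum 1) simp_all
    then show ?thesis by (simp add: algebra_simps)
  qed
  have e: "{1..3::nat} = {1, 2, 3}" by auto
  show ?thesis using that[of u] 1 2 3 unfolding e by blast
qed

text \<open>\<open>\<sigma>\<close> permutes the three coordinate forms up to its sign, since \<open>coord k (gen l)\<close> is
  alternating in \<open>(k, l)\<close>.\<close>

lemma coord_gen_sign:
  assumes "\<sigma> permutes {1..3::nat}"
  obtains s :: int where "s = 1 \<or> s = -1"
    "\<And>k x y. k \<in> {1..3} \<Longrightarrow>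
      coord (\<sigma> k) (x * fst (gen (\<sigma> 1)) + y * fst (gen (\<sigma> 2)), x * snd (gen (\<sigma> 1)) + y * snd (gen (\<sigma> 2)))
        = s * coord k (x, y)"
proof -
  have e: "{1..3::nat} = {1, 2, 3}" by auto
  have "\<sigma> i \<in> {1, 2, 3}" if "i \<in> {1, 2, 3}" for i
    using that permutes_in_image[OF assms] unfolding e by blast
  then have r: "\<sigma> 1 \<in> {1, 2, 3}" "\<sigma> 2 \<in> {1, 2, 3}" "\<sigma> 3 \<in> {1, 2, 3}" by blast+
  have ne: "\<sigma> 1 \<noteq> \<sigma> 2" "\<sigma> 1 \<noteq> \<sigma> 3" "\<sigma> 2 \<noteq> \<sigma> 3"
    using permutes_inj[OF assms] by (simp_all add: inj_eq)
  \<comment> \<open>This is the sign of \<open>\<sigma>\<close>: the listed pairs are the values at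
    1 and 2 of the identity and of the two 3-cycles.\<close>
  define s :: int where "s = (if (\<sigma> 1, \<sigma> 2) \<in> {(1, 2), (2, 3), (3, 1)} then 1 else -1)"
  have "coord (\<sigma> k) (x * fst (gen (\<sigma> 1)) + y * fst (gen (\<sigma> 2)), x * snd (gen (\<sigma> 1)) + y * snd (gen (\<sigma> 2)))
        = s * coord k (x, y)" if "k \<in> {1..3}" for k x y
    using r ne that unfolding e
    by (elim insertE emptyE) (simp_all add: s_def coord_def gen_def)
  moreover have "s = 1 \<or> s = -1" by (simp add: s_def)
  ultimately show ?thesis using that by blast
qed

section \<open>Lines and triangles\<close>

locale cyclic_latin_square =
  fixes n :: nat
  assumes n4: "n \<ge> 4"
begin

abbreviation V where "V \<equiv> carrier (Zn_sq n)"
abbreviation adj where "adj p q \<equiv> (p, q) \<in> parcs (Gamma n)"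

lemma V_eq: "V = {0..<int n} \<times> {0..<int n}"
  using n4 by (simp add: Zn_sq_simps)

text \<open>Lines of different directions share at most one vertex. The third form agrees by the
  zero sum, and forms 1 and 2 are up to sign the entries, which are reduced residues.\<close>

lemma eqI_par:
  assumes V: "p \<in> V" "q \<in> V" and kl: "k \<in> {1..3}" "l \<in> {1..3}" "k \<noteq> l"
    and par: "par n k p q" "par n l p q"
  shows "p = q"
proof -
  obtain m where m: "{k, l, m} = {1..3}" using triangle_indices[OF kl] by metis
  have all: "par n i p q" if "i \<in> {1..3}" for i
    using that par par_third[OF m par] unfolding m[symmetric] by blast
  have "[snd p = snd q] (mod int n)" "[fst p = fst q] (mod int n)"
    using all[of 1] all[of 2] by (simp_all add: par_def coord_def cong_minus_minus_iff)
  then show ?thesis using V unfolding V_eq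
    by (cases p; cases q) (auto simp: cong_def)
qed

lemma par_unique:
  assumes "p \<in> V" "q \<in> V" "p \<noteq> q" "k \<in> {1..3}" "l \<in> {1..3}" "par n k p q" "par n l p q"
  shows "k = l"
  using eqI_par assms by blast

text \<open>Lines of different directions always meet: any two of the forms can be solved over the
  integers, by \<open>q\<close>, and reducing the entries modulo \<open>n\<close> gives a
  vertex.\<close>

lemma ex_coords:
  assumes kl: "k \<in> {1..3}" "l \<in> {1..3}" "k \<noteq> l"
  obtains p where "p \<in> V" "[coord k p = a] (mod int n)" "[coord l p = b] (mod int n)"
proof -
  define q where "q =
    (if k = 1 then (if l = 2 then (-b, a) else (a + b, a))
     else if k = 2 then (if l = 1 then (-a, b) else (-a, -a - b))
     else (if l = 1 then (a + b, b) else (-b, -b - a)))"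
  have e: "{1..3::nat} = {1, 2, 3}" by auto
  have q: "coord k q = a" "coord l q = b"
    using kl unfolding e by (auto simp: q_def coord_def)
  define p where "p = (fst q mod int n, snd q mod int n)"
  have "p \<in> V" using n4 by (simp add: p_def V_eq)
  moreover have "[coord i p = coord i q] (mod int n)" for i
    by (simp add: p_def coord_def cong_diff cong_minus_minus_iff)
  ultimately show ?thesis using that q by metis
qed

text \<open>The three families in \<open>conn_set n\<close> are the nonzero multiples of
  \<open>gen 1\<close>, \<open>gen 2\<close> and \<open>gen 3\<close>, and the multiples of
  \<open>gen k\<close> are the differences on which \<open>coord k\<close> vanishes modulo
  \<open>n\<close>.\<close>

lemma adj_iff:
  assumes "p \<in> V" "q \<in> V"
  shows "adj p q \<longleftrightarrow> p \<noteq> q \<and> (\<exists>k\<in>{1..3}. par n k p q)"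
proof -
  obtain a b c d where e: "p = (a, b)" "q = (c, d)" by (cases p; cases q)
  have r: "0 \<le> a" "a < int n" "0 \<le> b" "b < int n" "0 \<le> c" "c < int n" "0 \<le> d" "d < int n"
    using assms by (auto simp: e V_eq)
  have k: "{1..3::nat} = {1, 2, 3}" by auto
  have z: "(x - y) mod int n = 0 \<longleftrightarrow> x = y" if "0 \<le> x" "x < int n" "0 \<le> y" "y < int n" for x y
    using that by (metis cong_iff_dvd_diff cong_less_imp_eq_int dvd_eq_mod_eq_0 cong_refl)
  have i: "x mod int n \<in> {1..int n - 1} \<longleftrightarrow> x mod int n \<noteq> 0" for x
    using n4 pos_mod_bound[of "int n" x] pos_mod_sign[of "int n" x] by (auto simp del: pos_mod_bound pos_mod_sign)
  have p1: "par n 1 p q \<longleftrightarrow> d = b"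
    using z[of d b] r by (simp add: par_def coord_def e cong_iff_dvd_diff dvd_eq_mod_eq_0[symmetric] dvd_diff_commute) 
  have p2: "par n 2 p q \<longleftrightarrow> c = a"
    using z[of c a] r by (simp add: par_def coord_def e cong_iff_dvd_diff dvd_eq_mod_eq_0[symmetric])
  have p3: "par n 3 p q \<longleftrightarrow> (c - a) mod int n = (d - b) mod int n"
    by (simp add: par_def coord_def e cong_iff_dvd_diff mod_eq_dvd_iff) (simp add: algebra_simps dvd_diff_commute)
  have "adj p q \<longleftrightarrow> ((c - a) mod int n, (d - b) mod int n) \<in> conn_set n"
    using r n4 by (simp add: e Gamma_arc_iff)
  also have "\<dots> \<longleftrightarrow> p \<noteq> q \<and> (d = b \<or> c = a \<or> (c - a) mod int n = (d - b) mod int n)"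
    unfolding conn_set_iff i using z[of c a] z[of d b] r by (auto simp: e)
  finally show ?thesis unfolding k by (simp only: bex_simps p1 p2 p3 simp_thms)
qed

lemma adj_par: "\<lbrakk>p \<in> V; q \<in> V; p \<noteq> q; k \<in> {1..3}; par n k p q\<rbrakk> \<Longrightarrow> adj p q"
  using adj_iff by blast

section \<open>Collinearity expressed through common neighbours\<close>

definition common_nbr where
  "common_nbr p q r \<longleftrightarrow> (\<exists>s\<in>V. adj s p \<and> adj s q \<and> adj s r)"

definition triangle where
  "triangle p q r \<longleftrightarrow> adj p q \<and> adj q r \<and> adj p r"

definition collinear where
  "collinear p q r \<longleftrightarrow> (\<exists>k\<in>{1..3}. par n k p q \<and> par n k p r)"

text \<open>For adjacent \<open>p\<close>, \<open>q\<close>: \<open>weak p q\<close> is a graph-theoretic form of \<open>2 * (p - q) \<noteq> 0\<close>, i.e. of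
  \<open>\<not> half p q\<close> (see \<open>weak_iff_not_half\<close>).\<close>

definition weak where
  "weak p q \<longleftrightarrow> (\<exists>r\<in>V. triangle p q r \<and> \<not> common_nbr p q r)"

definition half where
  "half p q \<longleftrightarrow> (\<forall>k\<in>{1..3}. [2 * coord k p = 2 * coord k q] (mod int n))"

lemma common_nbr_perm: "common_nbr p q r \<longleftrightarrow> common_nbr q p r" "common_nbr p q r \<longleftrightarrow> common_nbr p r q"
  by (auto simp: common_nbr_def)

lemma halfI:
  assumes "{k, l, m} = {1..3}" "par n k p q" "[2 * coord l p = 2 * coord l q] (mod int n)"
  shows "half p q"
proof -
  have k: "[2 * coord k p = 2 * coord k q] (mod int n)"
    using assms(2) unfolding par_def by (rule cong_scalar_left)
  have "[2 * coord m p = 2 * coord m q] (mod int n)"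
    by (rule cong_zero_sum[OF _ _ k assms(3)])
      (use coord_sum[OF assms(1), of p] coord_sum[OF assms(1), of q] in simp_all)
  then show ?thesis unfolding half_def assms(1)[symmetric] using k assms(3) by blast
qed

text \<open>Two edges of the same direction would put all three vertices on one line by
  transitivity, so the edges carry three different directions.\<close>

lemma triangleE:
  assumes V: "p \<in> V" "q \<in> V" "r \<in> V" and t: "triangle p q r" and nc: "\<not> collinear p q r"
  obtains k l m where "{k, l, m} = {1..3}" "k \<noteq> l" "k \<noteq> m" "l \<noteq> m"
    "par n k p q" "par n l p r" "par n m q r"
proof -
  obtain k l m where k: "k \<in> {1..3}" "par n k p q" and l: "l \<in> {1..3}" "par n l p r"
    and m: "m \<in> {1..3}" "par n m q r"
    using t V by (auto simp: triangle_def adj_iff)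
  have "collinear p q r" if "i \<in> {1..3}" "par n i p q" "par n i p r" for i
    using that unfolding collinear_def by blast
  then have d: "k \<noteq> l" "k \<noteq> m" "l \<noteq> m"
    using k l m nc par_trans[of n k p q r] par_trans[of n l p r q] par_sym[of n l q r] by blast+
  have "{k, l, m} = {1..3}"
    using k(1) l(1) m(1) d by (intro card_subset_eq) auto
  then show ?thesis by (rule that[OF _ d k(2) l(2) m(2)])
qed

text \<open>Write \<open>x\<close> for the change of the \<open>l\<close>-coordinate from \<open>p\<close> to \<open>q\<close>. A common neighbour of the
  triangle must have the same \<open>m\<close>-coordinate as \<open>p\<close>, the same \<open>k\<close>-coordinate as \<open>r\<close> and the same
  \<open>l\<close>-coordinate as \<open>q\<close>; as the three coordinates sum to zero, this forces \<open>2 * x = 0\<close>.\<close>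

lemma common_nbr_iff_half:
  assumes V: "p \<in> V" "q \<in> V" "r \<in> V" and I: "{k, l, m} = {1..3}" and d: "k \<noteq> l" "k \<noteq> m" "l \<noteq> m"
    and par: "par n k p q" "par n l p r" "par n m q r" and ne: "p \<noteq> q" "p \<noteq> r" "q \<noteq> r"
  shows "common_nbr p q r \<longleftrightarrow> half p q"
proof -
  have i: "k \<in> {1..3}" "l \<in> {1..3}" "m \<in> {1..3}" using I by blast+
  have dvd: "int n dvd coord k p - coord k q" "int n dvd coord l p - coord l r"
    "int n dvd coord m q - coord m r"
    using par by (simp_all add: par_def cong_iff_dvd_diff)
  note sum = coord_sum[OF I]
  show ?thesis
  proof
    assume "common_nbr p q r"
    then obtain s where s: "s \<in> V" "adj s p" "adj s q" "adj s r"
      by (auto simp: common_nbr_def)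
    have sne: "s \<noteq> p" "s \<noteq> q" "s \<noteq> r" using s V by (auto simp: adj_iff)
    have ex: "par n k s v \<or> par n l s v \<or> par n m s v" if "v \<in> V" "adj s v" for v
      using that s(1) unfolding adj_iff[OF s(1) that(1)] I[symmetric] by blast
    have un: "\<not> (par n k s v \<and> par n l s v)" "\<not> (par n k s v \<and> par n m s v)"
      "\<not> (par n l s v \<and> par n m s v)" if "v \<in> V" "s \<noteq> v" for v
      using eqI_par[OF s(1) that(1)] that(2) i d by blast+
    have "par n k s p \<longleftrightarrow> par n k s q" "par n l s p \<longleftrightarrow> par n l s r" "par n m s q \<longleftrightarrow> par n m s r"
      using par par_trans par_sym by meson+
    moreover have "\<not> par n k p r" "\<not> par n l p q" "\<not> par n m p q"
      using par ne eqI_par[OF V(1,2)] eqI_par[OF V(1,3)] i d by blast+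
    then have "\<not> (par n k s p \<and> par n k s r)" "\<not> (par n l s p \<and> par n l s q)"
      "\<not> (par n m s p \<and> par n m s q)"
      using par_trans par_sym by blast+
    \<comment> \<open>If \<open>s\<close> lay on a side line, it would be joined to the opposite
      vertex in the direction of another side, hence lie on that side too and be joined to one
      vertex in two directions. So \<open>s\<close> is joined to each vertex in the direction of the
      opposite side.\<close>
    ultimately have "par n m s p \<and> par n l s q \<and> par n k s r"
      using ex[OF V(1) s(2)] ex[OF V(2) s(3)] ex[OF V(3) s(4)]
        un[OF V(1) sne(1)] un[OF V(2) sne(2)] un[OF V(3) sne(3)] by argo
    then have "int n dvd coord m s - coord m p" "int n dvd coord l s - coord l q"
      "int n dvd coord k s - coord k r"
      by (simp_all add: par_def cong_iff_dvd_diff)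
    moreover have "2 * coord l p - 2 * coord l q =
        (coord m s - coord m p) + (coord l s - coord l q) + (coord k s - coord k r)
        - (coord k p - coord k q) + (coord l p - coord l r) + (coord m q - coord m r)"
      using sum[of p] sum[of q] sum[of r] sum[of s] by simp
    ultimately have "int n dvd 2 * coord l p - 2 * coord l q"
      using dvd by (metis dvd_add dvd_diff)
    then show "half p q" using halfI[OF I par(1)] by (simp add: cong_iff_dvd_diff)
  next
    assume "half p q"
    then have h: "int n dvd 2 * coord l p - 2 * coord l q"
      using i by (auto simp: half_def cong_iff_dvd_diff)
    \<comment> \<open>The intersection of two of the three lines forced in the other direction of
      the proof; \<open>h\<close> puts it on the third.\<close>
    obtain s where s: "s \<in> V" "[coord m s = coord m p] (mod int n)" "[coord k s = coord k r] (mod int n)"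
      using ex_coords[of m k "coord m p" "coord k r"] i d by metis
    have sd: "int n dvd coord m s - coord m p" "int n dvd coord k s - coord k r"
      using s by (simp_all add: cong_iff_dvd_diff)
    have "coord l s - coord l q = (2 * coord l p - 2 * coord l q) - (coord m s - coord m p)
        - (coord k s - coord k r) + (coord k p - coord k q) - (coord l p - coord l r) - (coord m q - coord m r)"
      using sum[of p] sum[of q] sum[of r] sum[of s] by simp
    then have "int n dvd coord l s - coord l q"
      using dvd sd h by (metis dvd_add dvd_diff)
    then have P: "par n l s q" "par n m s p" "par n k s r"
      using s by (simp_all add: par_def cong_iff_dvd_diff)
    have "s \<noteq> p" "s \<noteq> q" "s \<noteq> r"
      using P par ne eqI_par[OF V(1,2)] eqI_par[OF V(1,3)] eqI_par[OF V(2,3)] i d par_sym by metis+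
    then show "common_nbr p q r"
      using P V s(1) i adj_par unfolding common_nbr_def by blast
  qed
qed

lemma adj_neq: "p \<in> V \<Longrightarrow> q \<in> V \<Longrightarrow> adj p q \<Longrightarrow> p \<noteq> q"
  by (simp add: adj_iff)

text \<open>The existence of a common neighbour does not depend on the order of the vertices, so the
  criterion for one side transfers to the others by relabelling the triangle.\<close>

lemma common_nbr_noncollinear:
  assumes V: "p \<in> V" "q \<in> V" "r \<in> V" and t: "triangle p q r" and nc: "\<not> collinear p q r"
  shows "common_nbr p q r \<longleftrightarrow> half p q" "common_nbr p q r \<longleftrightarrow> half p r" "common_nbr p q r \<longleftrightarrow> half q r"
proof -
  obtain k l m where I: "{k, l, m} = {1..3}" "k \<noteq> l" "k \<noteq> m" "l \<noteq> m"
    and par: "par n k p q" "par n l p r" "par n m q r"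
    using triangleE[OF assms] .
  have ne: "p \<noteq> q" "p \<noteq> r" "q \<noteq> r"
    using t V adj_neq by (auto simp: triangle_def)
  show "common_nbr p q r \<longleftrightarrow> half p q"
    using common_nbr_iff_half[OF V I par ne] .
  show "common_nbr p q r \<longleftrightarrow> half p r"
    using common_nbr_iff_half[of p r q l k m] V I par ne common_nbr_perm par_sym
    by (metis insert_commute)
  show "common_nbr p q r \<longleftrightarrow> half q r"
    using common_nbr_iff_half[of q r p m k l] V I par ne common_nbr_perm par_sym
    by (metis insert_commute)
qed

text \<open>A line has \<open>n\<close> points, at least four. A second coordinate tells them apart,
  and some residue \<open>j\<close> is not taken by \<open>p\<close>, \<open>q\<close> or
  \<open>r\<close>.\<close>

lemma common_nbr_collinear:
  assumes V: "p \<in> V" "q \<in> V" "r \<in> V" and c: "collinear p q r"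
  shows "common_nbr p q r"
proof -
  obtain k where k: "k \<in> {1..3}" "par n k p q" "par n k p r"
    using c by (auto simp: collinear_def)
  obtain l where l: "l \<in> {1..3}" "k \<noteq> l" using other_index .
  let ?B = "(\<lambda>v. coord l v mod int n) ` {p, q, r}"
  have "card ?B \<le> 3"
    by (rule order_trans[OF card_image_le]) (auto simp: card_insert_if)
  then have "\<not> {0..<int n} \<subseteq> ?B"
    using card_mono[of ?B "{0..<int n}"] n4 by auto
  then obtain j where j: "j \<in> {0..<int n}" "j \<notin> ?B" by blast
  obtain s where s: "s \<in> V" "[coord k s = coord k p] (mod int n)" "[coord l s = j] (mod int n)"
    using ex_coords[OF k(1) l] by metis
  have js: "coord l s mod int n = j" using s(3) j(1) by (simp add: cong_def)
  have "par n k s v" if "v \<in> {p, q, r}" for v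
    using s(2) k that par_trans unfolding par_def[symmetric] by blast
  moreover have "s \<noteq> v" if "v \<in> {p, q, r}" for v
    using j(2) js that by blast
  ultimately have "adj s v" if "v \<in> {p, q, r}" for v
    using that adj_par[OF s(1)] k(1) V by blast
  then show ?thesis using s(1) unfolding common_nbr_def by blast
qed

text \<open>A triangle without common neighbours cannot be collinear, so the criterion for
  non-collinear triangles applies to it. Conversely, the edge is completed to a non-collinear
  triangle by intersecting lines of the two other directions through its ends.\<close>

lemma weak_iff_not_half:
  assumes V: "p \<in> V" "q \<in> V" and pq: "adj p q"
  shows "weak p q \<longleftrightarrow> \<not> half p q"
proof
  assume "weak p q"
  then show "\<not> half p q"
    using common_nbr_collinear common_nbr_noncollinear(1) V unfolding weak_def by blast
next
  assume nh: "\<not> half p q"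
  obtain k where k: "k \<in> {1..3}" "par n k p q" and ne: "p \<noteq> q" using pq V by (auto simp: adj_iff)
  obtain l where l: "l \<in> {1..3}" "k \<noteq> l" using other_index .
  obtain m where m: "m \<in> {1..3}" "m \<noteq> k" "m \<noteq> l" "{k, l, m} = {1..3}"
    using triangle_indices[OF k(1) l] .
  obtain r where r: "r \<in> V" "[coord l r = coord l p] (mod int n)" "[coord m r = coord m q] (mod int n)"
    using ex_coords[of l m "coord l p" "coord m q"] l m by metis
  have P: "par n l p r" "par n m q r" using r par_sym by (simp_all add: par_def cong_sym)
  have N: "p \<noteq> r" "q \<noteq> r"
    using P k ne eqI_par[OF V] l m par_sym by metis+
  have "triangle p q r"
    using P N adj_par r(1) V l m pq by (auto simp: triangle_def)
  moreover have "\<not> common_nbr p q r"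
    using common_nbr_iff_half[of p q r k l m] V r(1) m l k P N ne nh by auto
  ultimately show "weak p q" using r(1) by (auto simp: weak_def)
qed

text \<open>This characterizes collinearity purely in terms of adjacency, uniformly in \<open>n \<ge> 4\<close>. A collinear
  triangle has a fourth point on its line, and the differences of its vertices cannot all be of
  order two; an edge whose difference is not of order two lies in a triangle without common
  neighbours. A non-collinear triangle with a common neighbour has only differences of order two.
  For \<open>n = 4\<close> the size of the cliques alone would not suffice, since the cosets of
  \<open>{0, 2} \<times> {0, 2}\<close> are cliques as large as the lines.\<close>

lemma collinear_iff:
  assumes V: "p \<in> V" "q \<in> V" "r \<in> V" and t: "triangle p q r"
  shows "collinear p q r \<longleftrightarrow> common_nbr p q r \<and> (weak p q \<or> weak p r)"
proof
  assume c: "collinear p q r"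
  then obtain k where k: "k \<in> {1..3}" "par n k p q" "par n k p r"
    by (auto simp: collinear_def)
  obtain l where l: "l \<in> {1..3}" "k \<noteq> l" using other_index .
  have ne: "p \<noteq> q" "p \<noteq> r" "q \<noteq> r"
    using t V adj_neq by (auto simp: triangle_def)
  have "par n k q r" using k par_trans par_sym by blast
  then have np: "\<not> par n l p q" "\<not> par n l p r" "\<not> par n l q r"
    using eqI_par V ne k l by metis+
  have "\<not> (half p q \<and> half p r)"
  proof
    assume "half p q \<and> half p r"
    then have "int n dvd 2 * (coord l p - coord l q)" "int n dvd 2 * (coord l p - coord l r)"
      using l by (auto simp: half_def cong_iff_dvd_diff algebra_simps)
    from cong_double_zero[OF this] have "int n dvd coord l r - coord l q"
      using np by (simp add: par_def cong_iff_dvd_diff)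
    then show False using np(3) par_sym by (metis par_def cong_iff_dvd_diff)
  qed
  then show "common_nbr p q r \<and> (weak p q \<or> weak p r)"
    using common_nbr_collinear[OF V c] weak_iff_not_half V t by (auto simp: triangle_def)
next
  assume "common_nbr p q r \<and> (weak p q \<or> weak p r)"
  then show "collinear p q r"
    using common_nbr_noncollinear[OF V t] weak_iff_not_half V t unfolding triangle_def by blast
qed

lemma ex_par:
  assumes "v \<in> V" "k \<in> {1..3}"
  obtains w where "w \<in> V" "w \<noteq> v" "par n k v w"
proof -
  obtain l where l: "l \<in> {1..3}" "k \<noteq> l" using other_index .
  obtain w where w: "w \<in> V" "[coord k w = coord k v] (mod int n)"
    "[coord l w = coord l v + 1] (mod int n)"
    using ex_coords[OF assms(2) l] .
  have "w \<noteq> v"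
  proof
    assume "w = v"
    then have "int n dvd 1" using w(3) by (simp add: cong_iff_dvd_diff)
    then show False using n4 by simp
  qed
  then show ?thesis using that w by (simp add: par_def cong_sym)
qed

section \<open>Affine maps\<close>

abbreviation H where "H \<equiv> unit_sym_group n"
abbreviation act where "act \<equiv> unit_sym_action n"

definition affine where
  "affine = (\<lambda>(a, h). restrict (\<lambda>z. a \<otimes>\<^bsub>Zn_sq n\<^esub> act h z) V)"

lemma coord_mod: "[coord k (x mod int n, y mod int n) = coord k (x, y)] (mod int n)"
  by (simp add: coord_def cong_diff cong_minus_minus_iff)

lemma coord_act:
  assumes "\<sigma> permutes {1..3}"
  obtains s :: int where "s = 1 \<or> s = -1"
    "\<And>u k z. k \<in> {1..3} \<Longrightarrow> z \<in> V \<Longrightarrow> [coord (\<sigma> k) (act (u, \<sigma>) z) = s * u * coord k z] (mod int n)"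
proof -
  obtain s :: int where s: "s = 1 \<or> s = -1"
    "\<And>k x y. k \<in> {1..3} \<Longrightarrow>
      coord (\<sigma> k) (x * fst (gen (\<sigma> 1)) + y * fst (gen (\<sigma> 2)), x * snd (gen (\<sigma> 1)) + y * snd (gen (\<sigma> 2)))
        = s * coord k (x, y)"
    using coord_gen_sign[OF assms] by blast
  have scale: "coord i (u * x, u * y) = u * coord i (x, y)" for i u x y
    by (simp add: coord_def algebra_simps)
  have "[coord (\<sigma> k) (act (u, \<sigma>) z) = s * u * coord k z] (mod int n)"
    if k: "k \<in> {1..3}" and z: "z \<in> V" for u k z
  proof -
    obtain x y where xy: "z = (x, y)" by (cases z)
    let ?x = "x * fst (gen (\<sigma> 1)) + y * fst (gen (\<sigma> 2))"
    let ?y = "x * snd (gen (\<sigma> 1)) + y * snd (gen (\<sigma> 2))"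
    have "[coord (\<sigma> k) (act (u, \<sigma>) z) = coord (\<sigma> k) (u * ?x, u * ?y)] (mod int n)"
      unfolding xy unit_sym_action_apply[OF z[unfolded xy]] by (rule coord_mod)
    then show ?thesis unfolding scale s(2)[OF k] by (simp add: xy mult.assoc mult.left_commute)
  qed
  then show ?thesis using that s(1) by blast
qed

lemma H_carrier: "carrier H = {u. 0 < u \<and> u < int n \<and> coprime u (int n)} \<times> {\<sigma>. \<sigma> permutes {1..3}}"
  using n4 by (simp add: unit_sym_group_simps)

lemma act_hom: "act \<in> hom H (AutoGroup (Zn_sq n))"
  using n4 by (simp add: unit_sym_action_hom)

lemma act_auto: "h \<in> carrier H \<Longrightarrow> act h \<in> auto (Zn_sq n)"
  using act_hom by (auto simp: hom_def AutoGroup_def)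

lemma act_V: "h \<in> carrier H \<Longrightarrow> z \<in> V \<Longrightarrow> act h z \<in> V"
  using act_auto[of h] by (auto simp: auto_def hom_def)

lemma act_mult:
  "\<lbrakk>h \<in> carrier H; z \<in> V; w \<in> V\<rbrakk> \<Longrightarrow> act h (z \<otimes>\<^bsub>Zn_sq n\<^esub> w) = act h z \<otimes>\<^bsub>Zn_sq n\<^esub> act h w"
  using act_auto[of h] by (auto simp: auto_def hom_def)

lemma act_comp: "\<lbrakk>h \<in> carrier H; k \<in> carrier H; z \<in> V\<rbrakk> \<Longrightarrow> act (h \<otimes>\<^bsub>H\<^esub> k) z = act h (act k z)"
  using n4 by (cases h; cases k) (simp add: H_carrier unit_sym_group_simps unit_sym_action_comp)

sublocale Z: group "Zn_sq n"
  by (rule group_Zn_sq)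

lemma one_V: "\<one>\<^bsub>Zn_sq n\<^esub> = (0, 0)"
  using n4 by (simp add: Zn_sq_simps)

lemma act_one: "h \<in> carrier H \<Longrightarrow> act h (0, 0) = (0, 0)"
  using n4 by (cases h) (simp add: unit_sym_action_apply V_eq)

lemma coord_mult: "[coord k (a \<otimes>\<^bsub>Zn_sq n\<^esub> b) = coord k a + coord k b] (mod int n)"
proof -
  obtain x y x' y' where e: "a = (x, y)" "b = (x', y')" by (cases a; cases b)
  have "[coord k (a \<otimes>\<^bsub>Zn_sq n\<^esub> b) = coord k (x + x', y + y')] (mod int n)"
    using coord_mod n4 by (simp add: e Zn_sq_simps)
  then show ?thesis by (simp add: e coord_def algebra_simps split: if_splits)
qed

lemma affine_apply: "z \<in> V \<Longrightarrow> affine (a, h) z = a \<otimes>\<^bsub>Zn_sq n\<^esub> act h z"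
  by (simp add: affine_def)

lemma affine_V: "\<lbrakk>a \<in> V; h \<in> carrier H; z \<in> V\<rbrakk> \<Longrightarrow> affine (a, h) z \<in> V"
  by (simp add: affine_apply act_V)

text \<open>The sign depends on \<open>\<sigma>\<close> alone, so maps with the same
  \<open>\<sigma>\<close> and different units can be compared, and the unit can be chosen after the
  sign.\<close>

lemma affine_coord:
  assumes "\<sigma> permutes {1..3}"
  obtains s :: int where "s = 1 \<or> s = -1"
    "\<And>a u k z. k \<in> {1..3} \<Longrightarrow> z \<in> V \<Longrightarrow>
      [coord (\<sigma> k) (affine (a, u, \<sigma>) z) = coord (\<sigma> k) a + s * u * coord k z] (mod int n)"
proof -
  obtain s :: int where s: "s = 1 \<or> s = -1"
    "\<And>u k z. k \<in> {1..3} \<Longrightarrow> z \<in> V \<Longrightarrow> [coord (\<sigma> k) (act (u, \<sigma>) z) = s * u * coord k z] (mod int n)"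
    using coord_act[OF assms] by metis
  have "[coord (\<sigma> k) (affine (a, u, \<sigma>) z) = coord (\<sigma> k) a + s * u * coord k z] (mod int n)"
    if "k \<in> {1..3}" "z \<in> V" for a u k z
    using cong_trans[OF coord_mult cong_add[OF cong_refl s(2)[OF that]]] that(2)
    by (simp add: affine_apply)
  then show ?thesis using that s(1) by blast
qed

lemma affine_par:
  assumes "(u, \<sigma>) \<in> carrier H" "k \<in> {1..3}" "p \<in> V" "q \<in> V"
  shows "par n (\<sigma> k) (affine (a, u, \<sigma>) p) (affine (a, u, \<sigma>) q) \<longleftrightarrow> par n k p q"
proof -
  have \<sigma>: "\<sigma> permutes {1..3}" and u: "coprime u (int n)" using assms(1) by (auto simp: H_carrier)
  obtain s :: int where s: "s = 1 \<or> s = -1"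
    "\<And>a u k z. k \<in> {1..3} \<Longrightarrow> z \<in> V \<Longrightarrow>
      [coord (\<sigma> k) (affine (a, u, \<sigma>) z) = coord (\<sigma> k) a + s * u * coord k z] (mod int n)"
    using affine_coord[OF \<sigma>] by metis
  note c = s(2)[OF assms(2,3), of a u] s(2)[OF assms(2,4), of a u]
  have "par n (\<sigma> k) (affine (a, u, \<sigma>) p) (affine (a, u, \<sigma>) q) \<longleftrightarrow>
      [coord (\<sigma> k) a + s * u * coord k p = coord (\<sigma> k) a + s * u * coord k q] (mod int n)"
    unfolding par_def using c by (meson cong_sym cong_trans)
  also have "\<dots> \<longleftrightarrow> par n k p q"
    unfolding par_def cong_add_lcancel using s(1) u by (intro cong_mult_lcancel) auto
  finally show ?thesis .
qed

lemma affine_aut: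
  assumes a: "a \<in> V" and h: "h \<in> carrier H"
  shows "affine (a, h) \<in> graph_auts (Gamma n)"
proof -
  obtain u \<sigma> where us: "h = (u, \<sigma>)" by (cases h)
  have \<sigma>: "\<sigma> permutes {1..3}" using h by (simp add: us H_carrier)
  have V: "pverts (Gamma n) = V" by (simp add: Gamma_def cayley_graph_def)
  have bij: "bij_betw (act h) V V"
    using act_auto[OF h] by (simp add: auto_def Bij_def)
  have "inj_on (affine (a, h)) V"
    using bij a act_V[OF h] by (auto simp: inj_on_def bij_betw_def affine_apply)
  moreover have "affine (a, h) ` V \<subseteq> V" using affine_V a h by blast
  moreover have "finite V" by (simp add: V_eq)
  ultimately have bij: "bij_betw (affine (a, h)) V V"
    unfolding bij_betw_def by (simp add: endo_inj_surj)
  have "adj p q \<longleftrightarrow> adj (affine (a, h) p) (affine (a, h) q)" if "p \<in> V" "q \<in> V" for p q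
  proof -
    have "affine (a, h) p = affine (a, h) q \<longleftrightarrow> p = q"
      using bij that by (auto simp: bij_betw_def inj_on_def)
    moreover have "(\<exists>k\<in>{1..3}. par n k (affine (a, h) p) (affine (a, h) q)) \<longleftrightarrow>
        (\<exists>k\<in>{1..3}. par n (\<sigma> k) (affine (a, h) p) (affine (a, h) q))"
      using permutes_image[OF \<sigma>] by (metis imageE image_eqI)
    moreover have "\<dots> \<longleftrightarrow> (\<exists>k\<in>{1..3}. par n k p q)"
      using affine_par[OF h[unfolded us] _ that] unfolding us by blast
    ultimately show ?thesis
      unfolding adj_iff[OF that] adj_iff[OF affine_V[OF a h that(1)] affine_V[OF a h that(2)]] by simp
  qed
  then show ?thesis
    using bij by (simp add: graph_auts_def V Bij_def affine_def)
qed

text \<open>All data can be read off the map: the translation is the image of the origin,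
  \<open>\<sigma>\<close> is given by the directions of the images of the lines through the origin,
  and \<open>u\<close> is found from the image of \<open>(0, 1)\<close>, where
  \<open>coord 1\<close> is 1.\<close>

lemma affine_inj:
  assumes a: "a \<in> V" "b \<in> V" and h: "h \<in> carrier H" "h' \<in> carrier H"
    and eq: "affine (a, h) = affine (b, h')"
  shows "a = b \<and> h = h'"
proof -
  obtain u \<sigma> u' \<sigma>' where us: "h = (u, \<sigma>)" "h' = (u', \<sigma>')" by (cases h; cases h')
  have \<sigma>: "\<sigma> permutes {1..3}" "\<sigma>' permutes {1..3}" and u: "0 < u" "u < int n" "0 < u'" "u' < int n"
    using h by (auto simp: us H_carrier)
  have O: "(0, 0) \<in> V" using n4 by (simp add: V_eq)
  have r1: "c \<otimes>\<^bsub>Zn_sq n\<^esub> (0, 0) = c" if "c \<in> V" for c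
    using Z.r_one[OF that] by (simp only: one_V)
  have "affine (a, h) (0, 0) = a" "affine (b, h') (0, 0) = b"
    unfolding affine_apply[OF O] act_one[OF h(1)] act_one[OF h(2)] by (rule r1[OF a(1)], rule r1[OF a(2)])
  then have ab: "a = b" using eq by simp
  have "\<sigma> k = \<sigma>' k" for k
  proof (cases "k \<in> {1..3}")
    case True
    obtain w where w: "w \<in> V" "w \<noteq> (0, 0)" "par n k (0, 0) w"
      using ex_par[OF O True] .
    let ?f = "affine (a, h)"
    have "?f (0, 0) \<noteq> ?f w"
      using affine_aut[OF a(1) h(1)] w(1,2) O
      by (auto simp: graph_auts_def Bij_def bij_betw_def inj_on_def Gamma_def cayley_graph_def)
    moreover have "par n (\<sigma> k) (?f (0, 0)) (?f w)"
      using affine_par[OF h(1)[unfolded us] True O w(1)] w(3) by (simp add: us)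
    moreover have "par n (\<sigma>' k) (?f (0, 0)) (?f w)"
      using affine_par[OF h(2)[unfolded us] True O w(1)] w(3) unfolding eq by (simp add: us)
    ultimately show ?thesis
      using par_unique[OF affine_V[OF a(1) h(1) O] affine_V[OF a(1) h(1) w(1)]]
        permutes_in_image[OF \<sigma>(1)] permutes_in_image[OF \<sigma>(2)] True by blast
  next
    case False
    then show ?thesis using \<sigma> by (simp add: permutes_not_in)
  qed
  then have \<sigma>\<sigma>: "\<sigma> = \<sigma>'" by blast
  obtain s :: int where s: "s = 1 \<or> s = -1"
    "\<And>a u k z. k \<in> {1..3} \<Longrightarrow> z \<in> V \<Longrightarrow>
      [coord (\<sigma> k) (affine (a, u, \<sigma>) z) = coord (\<sigma> k) a + s * u * coord k z] (mod int n)"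
    using affine_coord[OF \<sigma>(1)] by metis
  have w: "1 \<in> {1..3::nat}" "(0, 1) \<in> V" using n4 by (auto simp: V_eq)
  have c: "[coord (\<sigma> 1) (affine (a, v, \<sigma>) (0, 1)) = coord (\<sigma> 1) a + s * v] (mod int n)" for v
    using s(2)[OF w, of a v] by (simp add: coord_def)
  have "affine (a, u, \<sigma>) = affine (a, u', \<sigma>)" using eq by (simp add: us ab \<sigma>\<sigma>)
  then have "[coord (\<sigma> 1) a + s * u = coord (\<sigma> 1) a + s * u'] (mod int n)"
    using cong_trans[OF cong_sym[OF c[of u]]] c[of u'] by simp
  then have "[s * u = s * u'] (mod int n)" by (simp only: cong_add_lcancel)
  then have "[u = u'] (mod int n)" using s(1) by (auto simp: cong_minus_minus_iff)
  then have "u = u'" using u by (simp add: cong_def)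
  then show ?thesis using ab \<sigma>\<sigma> us by simp
qed

lemma affine_hom:
  assumes "a \<in> V" "b \<in> V" "h \<in> carrier H" "k \<in> carrier H"
  shows "affine (a \<otimes>\<^bsub>Zn_sq n\<^esub> act h b, h \<otimes>\<^bsub>H\<^esub> k) = compose V (affine (a, h)) (affine (b, k))"
proof (rule extensionalityI[where A = V])
  fix z assume z: "z \<in> V"
  show "affine (a \<otimes>\<^bsub>Zn_sq n\<^esub> act h b, h \<otimes>\<^bsub>H\<^esub> k) z = compose V (affine (a, h)) (affine (b, k)) z"
    using assms z by (simp add: compose_eq affine_apply act_V act_comp act_mult Z.m_assoc)
qed (simp_all add: affine_def)

end

section \<open>Automorphisms preserve directions\<close>

locale cyclic_latin_square_aut = cyclic_latin_square +
  fixes f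
  assumes f: "f \<in> graph_auts (Gamma n)"
begin

lemma pverts_Gamma: "pverts (Gamma n) = V"
  by (simp add: Gamma_def cayley_graph_def)

lemma f_bij: "bij_betw f V V"
  using f by (simp add: graph_auts_def Bij_def pverts_Gamma)

lemma f_V: "p \<in> V \<Longrightarrow> f p \<in> V"
  using f_bij by (auto simp: bij_betw_def)

lemma f_inj: "p \<in> V \<Longrightarrow> q \<in> V \<Longrightarrow> f p = f q \<longleftrightarrow> p = q"
  using f_bij by (auto simp: bij_betw_def inj_on_def)

text \<open>Surjectivity of \<open>f\<close> moves the quantified vertex in
  \<open>common_nbr\<close> and \<open>weak\<close> to the image side.\<close>

lemma f_ex: "(\<exists>p\<in>V. P p) \<longleftrightarrow> (\<exists>p\<in>V. P (f p))"
  using f_bij by (metis bij_betw_def imageE image_eqI)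

lemma f_adj: "p \<in> V \<Longrightarrow> q \<in> V \<Longrightarrow> adj (f p) (f q) \<longleftrightarrow> adj p q"
  using f by (simp add: graph_auts_def pverts_Gamma)

lemma f_triangle: "\<lbrakk>p \<in> V; q \<in> V; r \<in> V\<rbrakk> \<Longrightarrow> triangle (f p) (f q) (f r) \<longleftrightarrow> triangle p q r"
  by (simp add: triangle_def f_adj)

lemma f_common_nbr: "\<lbrakk>p \<in> V; q \<in> V; r \<in> V\<rbrakk> \<Longrightarrow> common_nbr (f p) (f q) (f r) \<longleftrightarrow> common_nbr p q r"
  unfolding common_nbr_def f_ex[of "\<lambda>s. adj s (f p) \<and> adj s (f q) \<and> adj s (f r)"]
  by (simp add: f_adj cong: bex_cong)

lemma f_weak: "\<lbrakk>p \<in> V; q \<in> V\<rbrakk> \<Longrightarrow> weak (f p) (f q) \<longleftrightarrow> weak p q"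
  unfolding weak_def f_ex[of "\<lambda>r. triangle (f p) (f q) r \<and> \<not> common_nbr (f p) (f q) r"]
  by (simp add: f_triangle f_common_nbr cong: bex_cong)

lemma f_collinear:
  "\<lbrakk>p \<in> V; q \<in> V; r \<in> V; triangle p q r\<rbrakk> \<Longrightarrow> collinear (f p) (f q) (f r) \<longleftrightarrow> collinear p q r"
  by (simp add: collinear_iff f_V f_triangle f_common_nbr f_weak)

text \<open>One further point \<open>w0\<close> of the line fixes \<open>j\<close>. Any other
  \<open>w\<close> on it forms a collinear triangle with \<open>v\<close> and \<open>w0\<close>; its
  image is collinear, and \<open>f v\<close> and \<open>f w0\<close> already determine the
  line.\<close>

lemma local_direction:
  assumes v: "v \<in> V" and k: "k \<in> {1..3}"
  shows "\<exists>j\<in>{1..3}. \<forall>w\<in>V. par n k v w \<longrightarrow> par n j (f v) (f w)"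
proof -
  obtain w0 where w0: "w0 \<in> V" "w0 \<noteq> v" "par n k v w0" using ex_par[OF assms] .
  have "adj v w0" using adj_par[OF v w0(1)] w0 k by auto
  then have "adj (f v) (f w0)" using f_adj v w0 by simp
  then obtain j where j: "j \<in> {1..3}" "par n j (f v) (f w0)"
    using adj_iff f_V v w0(1) by blast
  have "par n j (f v) (f w)" if w: "w \<in> V" "par n k v w" for w
  proof (cases "w = v \<or> w = w0")
    case True
    then show ?thesis using j by auto
  next
    case False
    have "par n k w w0" using w w0 par_trans par_sym by blast
    then have "triangle v w w0"
      using adj_par k v w w0 False unfolding triangle_def by metis
    moreover have "collinear v w w0" using k w w0 by (auto simp: collinear_def)
    ultimately have "collinear (f v) (f w) (f w0)"
      using f_collinear v w w0 by blast
    then obtain i where "i \<in> {1..3}" "par n i (f v) (f w)" "par n i (f v) (f w0)"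
      by (auto simp: collinear_def)
    moreover from this have "i = j"
      using par_unique[of "f v" "f w0"] j f_V f_inj v w0 by metis
    ultimately show ?thesis by simp
  qed
  then show ?thesis using j(1) by blast
qed

section \<open>The induced permutation of directions and its constancy\<close>

definition dir where
  "dir v k = (SOME j. j \<in> {1..3} \<and> (\<forall>w\<in>V. par n k v w \<longrightarrow> par n j (f v) (f w)))"

lemma dir:
  assumes "v \<in> V" "k \<in> {1..3}"
  shows "dir v k \<in> {1..3}" "\<And>w. w \<in> V \<Longrightarrow> par n k v w \<Longrightarrow> par n (dir v k) (f v) (f w)"
  using someI_ex[of "\<lambda>j. j \<in> {1..3} \<and> (\<forall>w\<in>V. par n k v w \<longrightarrow> par n j (f v) (f w))"]
    local_direction[OF assms] unfolding dir_def by blast+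

lemma dir_edge:
  assumes "v \<in> V" "w \<in> V" "v \<noteq> w" "k \<in> {1..3}" "par n k v w"
  shows "dir v k = dir w k"
proof (rule par_unique[of "f v" "f w"])
  show "par n (dir v k) (f v) (f w)" using dir(2) assms by blast
  show "par n (dir w k) (f v) (f w)" using dir(2)[OF assms(2,4) assms(1)] assms(5) par_sym by blast
qed (use assms f_V f_inj dir(1) in auto)

text \<open>If two lines through \<open>v\<close> went to the same line, points \<open>w\<close> and
  \<open>t\<close> on them would have images collinear with \<open>f v\<close>. As \<open>f\<close>
  also reflects collinearity, \<open>v\<close>, \<open>w\<close>, \<open>t\<close> would be
  collinear and the two directions equal.\<close>

lemma dir_inj:
  assumes v: "v \<in> V" and k: "k \<in> {1..3}" and l: "l \<in> {1..3}" and e: "dir v k = dir v l"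
  shows "k = l"
proof (rule ccontr)
  assume ne: "k \<noteq> l"
  obtain w where w: "w \<in> V" "w \<noteq> v" "par n k v w" using ex_par[OF v k] .
  obtain t where t: "t \<in> V" "t \<noteq> v" "par n l v t" using ex_par[OF v l] .
  have wt: "w \<noteq> t" using par_unique[of v w k l] w t v k l ne by metis
  have d: "par n (dir v k) (f v) (f w)" "par n (dir v k) (f v) (f t)"
    using dir(2)[OF v k] dir(2)[OF v l] w t e by simp_all
  then have "par n (dir v k) (f w) (f t)" using par_trans par_sym by blast
  then have "triangle (f v) (f w) (f t)"
    using d adj_par[OF f_V f_V _ dir(1)[OF v k]] v w t wt f_inj unfolding triangle_def by metis
  moreover have "collinear (f v) (f w) (f t)"
    using d dir(1)[OF v k] by (auto simp: collinear_def)
  ultimately have "collinear v w t"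
    using f_collinear f_triangle v w(1) t(1) by blast
  then obtain i where i: "i \<in> {1..3}" "par n i v w" "par n i v t" by (auto simp: collinear_def)
  have "i = k" using par_unique[of v w i k] i w v k by metis
  moreover have "i = l" using par_unique[of v t i l] i t v l by metis
  ultimately show False using ne by simp
qed

lemma dir_range:
  assumes "v \<in> V" "{k, l, m} = {1..3}"
  shows "{dir v k, dir v l, dir v m} = {1..3}"
proof -
  have "inj_on (dir v) {1..3}" using dir_inj[OF assms(1)] by (auto intro: inj_onI)
  moreover have "dir v ` {1..3} \<subseteq> {1..3}" using dir(1)[OF assms(1)] by blast
  ultimately have "dir v ` {1..3} = {1..3}" by (intro endo_inj_surj) auto
  then show ?thesis unfolding assms(2)[symmetric] by simp
qed

text \<open>Complete the edge to a non-collinear triangle \<open>v, w, t\<close>. Its edges have the image directions \<open>dir v k\<close>, \<open>dir v l\<close> and \<open>dir w m\<close>, which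
  are distinct because each \<open>dir x\<close> is injective; hence \<open>dir w m\<close> is the remaining direction.\<close>

lemma dir_adj_third:
  assumes V: "v \<in> V" "w \<in> V" and ne: "v \<noteq> w" and I: "{k, l, m} = {1..3}"
    and d: "k \<noteq> l" "k \<noteq> m" "l \<noteq> m" and par: "par n k v w"
  shows "dir w m = dir v m"
proof -
  have i: "k \<in> {1..3}" "l \<in> {1..3}" "m \<in> {1..3}" using I by blast+
  obtain t where t: "t \<in> V" "[coord l t = coord l v] (mod int n)" "[coord m t = coord m w] (mod int n)"
    using ex_coords[OF i(2,3) d(3)] .
  have P: "par n l v t" "par n m w t" using t par_sym by (simp_all add: par_def cong_sym)
  have N: "v \<noteq> t" "w \<noteq> t"
    using P par par_sym par_unique[OF V ne] i d by metis+
  have e: "dir v k = dir w k" "dir v l = dir t l" "dir w m = dir t m"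
    using dir_edge V t(1) ne N par P i by blast+
  have "dir w m \<noteq> dir w k" "dir t m \<noteq> dir t l"
    using dir_inj V t(1) i d by metis+
  moreover have "dir w m \<in> {dir v k, dir v l, dir v m}"
    unfolding dir_range[OF V(1) I] by (rule dir(1)[OF V(2) i(3)])
  ultimately show ?thesis using e by auto
qed

lemma dir_adj:
  assumes V: "v \<in> V" "w \<in> V" and ne: "v \<noteq> w" and k: "k \<in> {1..3}" and par: "par n k v w"
    and m: "m \<in> {1..3}"
  shows "dir w m = dir v m"
proof (cases "m = k")
  case True
  then show ?thesis using dir_edge[OF V ne k par] by simp
next
  case False
  then obtain l where "l \<noteq> k" "l \<noteq> m" "{k, m, l} = {1..3}"
    using triangle_indices[OF k m] by metis
  then show ?thesis using dir_adj_third[OF V ne _ _ _ _ par, of l m] False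
    by (metis insert_commute)
qed

text \<open>Any two vertices are joined by at most two edges, through the intersection
  \<open>t\<close> of a line of direction 1 and a line of direction 2.\<close>

lemma dir_const:
  assumes V: "v \<in> V" "w \<in> V" and m: "m \<in> {1..3}"
  shows "dir w m = dir v m"
proof -
  have i: "1 \<in> {1..3::nat}" "2 \<in> {1..3::nat}" "1 \<noteq> (2::nat)" by auto
  obtain t where t: "t \<in> V" "[coord 1 t = coord 1 v] (mod int n)" "[coord 2 t = coord 2 w] (mod int n)"
    using ex_coords[OF i] .
  have "par n 1 v t" "par n 2 t w" using t by (simp_all add: par_def cong_sym)
  then have "dir t m = dir v m" "dir w m = dir t m"
    using dir_adj[OF V(1) t(1) _ _ _ m, of 1] dir_adj[OF t(1) V(2) _ _ _ m, of 2] by fastforce+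
  then show ?thesis by simp
qed

text \<open>By \<open>dir_const\<close> the choice of the origin is immaterial; the identity outside
  the index set is what \<open>permutes\<close> demands.\<close>

definition perm where
  "perm k = (if k \<in> {1..3} then dir (0, 0) k else k)"

lemma O_V: "(0, 0) \<in> V"
  using n4 by (simp add: V_eq)

lemma perm_permutes: "perm permutes {1..3}"
proof (rule bij_imp_permutes)
  have inj: "inj_on perm {1..3}" using dir_inj[OF O_V] by (auto intro: inj_onI simp: perm_def)
  have "perm ` {1..3} \<subseteq> {1..3}" using dir(1)[OF O_V] by (auto simp: perm_def)
  with inj show "bij_betw perm {1..3} {1..3}"
    unfolding bij_betw_def using endo_inj_surj[OF _ _ inj] by simp
qed (auto simp: perm_def)

lemma f_par:
  assumes "p \<in> V" "q \<in> V" "k \<in> {1..3}" "par n k p q"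
  shows "par n (perm k) (f p) (f q)"
  using dir(2)[OF assms(1,3,2,4)] dir_const[OF O_V assms(1,3)] assms(3) by (simp add: perm_def)

section \<open>Automorphisms are affine\<close>

text \<open>The choice of the vertex matters only up to multiples of \<open>n\<close>, because
  \<open>f_par\<close> makes the image coordinate depend only on \<open>coord k\<close>.\<close>

definition img where
  "img k a = coord (perm k) (f (SOME p. p \<in> V \<and> [coord k p = a] (mod int n)))"

lemma img:
  assumes p: "p \<in> V" and k: "k \<in> {1..3}" and a: "[coord k p = a] (mod int n)"
  shows "[coord (perm k) (f p) = img k a] (mod int n)"
proof -
  let ?q = "SOME p. p \<in> V \<and> [coord k p = a] (mod int n)"
  have q: "?q \<in> V" "[coord k ?q = a] (mod int n)"
    using someI[of "\<lambda>p. p \<in> V \<and> [coord k p = a] (mod int n)" p] p a by simp_all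
  then have "par n k p ?q" using a unfolding par_def by (meson cong_sym cong_trans)
  then have "par n (perm k) (f p) (f ?q)" using f_par p q(1) k by blast
  then show ?thesis by (simp add: par_def img_def)
qed

lemma perm_range: "{perm 1, perm 2, perm 3} = {1..3}"
proof -
  have e: "{1..3::nat} = {1, 2, 3}" by auto
  have "perm ` {1, 2, 3} = {1, 2, 3}" using permutes_image[OF perm_permutes] unfolding e .
  then show ?thesis unfolding e by simp
qed

text \<open>A vertex with first two coordinates \<open>a\<close> and \<open>b\<close> has third
  coordinate \<open>c\<close> modulo \<open>n\<close>, and the coordinates of its image, permuted by
  \<open>perm\<close>, again sum to zero.\<close>

lemma img_sum:
  assumes "a + b + c = 0"
  shows "int n dvd img 1 a + img 2 b + img 3 c"
proof -
  have i: "1 \<in> {1..3::nat}" "2 \<in> {1..3::nat}" "1 \<noteq> (2::nat)" "3 \<in> {1..3::nat}" by auto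
  obtain p where p: "p \<in> V" "[coord 1 p = a] (mod int n)" "[coord 2 p = b] (mod int n)"
    using ex_coords[OF i(1-3)] .
  have "coord 1 p + coord 2 p + coord 3 p = 0" by (rule coord_sum) auto
  then have "[coord 3 p = c] (mod int n)"
    using cong_zero_sum assms p(2,3) by blast
  then have "[coord (perm 1) (f p) + coord (perm 2) (f p) + coord (perm 3) (f p)
      = img 1 a + img 2 b + img 3 c] (mod int n)"
    using p i by (intro cong_add img) auto
  then show ?thesis
    unfolding coord_sum[OF perm_range] by (metis cong_0_iff cong_sym)
qed

lemma f_coord:
  obtains u where "\<And>k p. k \<in> {1..3} \<Longrightarrow> p \<in> V \<Longrightarrow>
    [coord (perm k) (f p) = coord (perm k) (f (0, 0)) + u * coord k p] (mod int n)"
proof -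
  obtain u where u: "\<And>k a. k \<in> {1..3} \<Longrightarrow> int n dvd img k a - img k 0 - u * a"
    using zero_sum_imp_affine[of "int n" img] img_sum by blast
  have "[coord (perm k) (f p) = coord (perm k) (f (0, 0)) + u * coord k p] (mod int n)"
    if k: "k \<in> {1..3}" and p: "p \<in> V" for k p
  proof -
    have "[coord (perm k) (f p) = img k (coord k p)] (mod int n)"
      "[coord (perm k) (f (0, 0)) = img k 0] (mod int n)"
      using img[OF p k cong_refl] img[OF O_V k, of 0] by (simp_all add: coord_def)
    then have "int n dvd (coord (perm k) (f p) - img k (coord k p))
        - (coord (perm k) (f (0, 0)) - img k 0) + (img k (coord k p) - img k 0 - u * coord k p)"
      using dvd_add[OF dvd_diff u[OF k]] unfolding cong_iff_dvd_diff by blast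
    then show ?thesis by (simp add: cong_iff_dvd_diff algebra_simps)
  qed
  then show ?thesis using that by blast
qed

lemma f_affine: "\<exists>x \<in> V \<times> carrier H. f = affine x"
proof -
  obtain u where u: "\<And>k p. k \<in> {1..3} \<Longrightarrow> p \<in> V \<Longrightarrow>
    [coord (perm k) (f p) = coord (perm k) (f (0, 0)) + u * coord k p] (mod int n)"
    using f_coord by metis
  obtain s :: int where s: "s = 1 \<or> s = -1"
    "\<And>a u k z. k \<in> {1..3} \<Longrightarrow> z \<in> V \<Longrightarrow>
      [coord (perm k) (affine (a, u, perm) z) = coord (perm k) a + s * u * coord k z] (mod int n)"
    using affine_coord[OF perm_permutes] by metis
  have i: "1 \<in> {1..3::nat}" "2 \<in> {1..3::nat}" "1 \<noteq> (2::nat)" by auto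
  have pi: "perm 1 \<in> {1..3}" "perm 2 \<in> {1..3}" "perm 1 \<noteq> perm 2"
    using permutes_in_image[OF perm_permutes] permutes_inj[OF perm_permutes] i by (auto simp: inj_eq)
  \<comment> \<open>A target one step away from \<open>f (0, 0)\<close> in the form
    \<open>perm 1\<close>; the coordinate of its preimage inverts the slope
    \<open>u\<close>.\<close>
  obtain q where q: "q \<in> V" "[coord (perm 1) q = coord (perm 1) (f (0, 0)) + 1] (mod int n)"
    using ex_coords[OF pi] by metis
  have "q \<in> f ` V" using q(1) bij_betw_imp_surj_on[OF f_bij] by simp
  then obtain p where p: "p \<in> V" "f p = q" by (metis imageE)
  have "[coord (perm 1) (f (0, 0)) + u * coord 1 p = coord (perm 1) (f (0, 0)) + 1] (mod int n)"
    using u[OF i(1) p(1)] q(2) p(2) cong_sym cong_trans by metis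
  then have "[u * coord 1 p = 1] (mod int n)" by (simp only: cong_add_lcancel)
  then have cop: "coprime u (int n)" using coprime_iff_invertible_int by blast
  \<comment> \<open>The action of \<open>(v, perm)\<close> scales the forms by \<open>s * v\<close>,
    so the factor \<open>s\<close> compensates the sign, as \<open>s * s = 1\<close>.\<close>
  define v where "v = (s * u) mod int n"
  have vc: "coprime v (int n)" using cop s(1) n4 by (auto simp: v_def)
  have "v \<noteq> 0" using vc n4 by auto
  moreover have "0 \<le> v" "v < int n" using n4 by (simp_all add: v_def)
  ultimately have h: "(v, perm) \<in> carrier H" using vc perm_permutes by (simp add: H_carrier)
  have sv: "[s * v = u] (mod int n)"
  proof -
    have "[s * v = s * (s * u)] (mod int n)" unfolding v_def by (intro cong_scalar_left) simp
    then show ?thesis using s(1) by (auto simp: mult.assoc[symmetric])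
  qed
  let ?a = "f (0, 0)"
  have a: "?a \<in> V" using f_V O_V .
  have "f z = affine (?a, v, perm) z" if z: "z \<in> V" for z
  proof (rule eqI_par[OF f_V[OF z] affine_V[OF a h z] pi])
    have "par n (perm k) (f z) (affine (?a, v, perm) z)" if k: "k \<in> {1..3}" for k
    proof -
      have "[coord (perm k) ?a + s * v * coord k z = coord (perm k) ?a + u * coord k z] (mod int n)"
        by (intro cong_add cong_refl cong_scalar_right sv)
      then show ?thesis using u[OF k z] s(2)[OF k z, of ?a v] unfolding par_def by (meson cong_sym cong_trans)
    qed
    then show "par n (perm 1) (f z) (affine (?a, v, perm) z)" "par n (perm 2) (f z) (affine (?a, v, perm) z)"
      using i by blast+
  qed
  moreover have "f \<in> extensional V" using f by (simp add: graph_auts_def Bij_def pverts_Gamma)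
  ultimately have "f = affine (?a, v, perm)"
    by (intro extensionalityI[where A = V]) (auto simp: affine_def)
  then show ?thesis using a h by blast
qed

end

theorem theorem2p3:
  fixes n :: nat
  assumes "n \<ge> 4"
  shows "graph_aut_group (Gamma n) \<cong>
           semidirect_product (Zn_sq n) (unit_sym_group n) (unit_sym_action n)"
proof -
  interpret cyclic_latin_square n using assms by unfold_locales
  let ?S = "semidirect_product (Zn_sq n) H act"
  have S: "carrier ?S = V \<times> carrier H" by (simp add: semidirect_product_def)
  have A: "carrier (graph_aut_group (Gamma n)) = graph_auts (Gamma n)"
    by (simp add: graph_aut_group_def)
  have "n > 1" using assms by simp
  \<comment> \<open>The isomorphism is constructed out of \<open>?S\<close>; that \<open>?S\<close>
    is a group serves to invert it.\<close>
  then have "group ?S"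
    by (intro group_semidirect_product group_Zn_sq group_unit_sym_group unit_sym_action_hom)
  moreover have "affine \<in> iso ?S (graph_aut_group (Gamma n))"
  proof (rule isoI)
    show "affine \<in> hom ?S (graph_aut_group (Gamma n))"
    proof (rule homI)
      fix x assume "x \<in> carrier ?S"
      then show "affine x \<in> carrier (graph_aut_group (Gamma n))"
        using affine_aut unfolding S A by blast
    next
      fix x y assume xy: "x \<in> carrier ?S" "y \<in> carrier ?S"
      obtain a h b k where e: "x = (a, h)" "y = (b, k)" by (cases x; cases y)
      have "a \<in> V" "b \<in> V" "h \<in> carrier H" "k \<in> carrier H" using xy unfolding S e by simp_all
      then show "affine (x \<otimes>\<^bsub>?S\<^esub> y) = affine x \<otimes>\<^bsub>graph_aut_group (Gamma n)\<^esub> affine y"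
        using affine_hom[of a b h k] affine_aut[of a h] affine_aut[of b k]
        by (simp add: e semidirect_product_def graph_aut_group_def BijGroup_def graph_auts_def
            Gamma_def cayley_graph_def)
    qed
    have "inj_on affine (V \<times> carrier H)"
      using affine_inj by (auto intro!: inj_onI)
    moreover have "affine ` (V \<times> carrier H) = graph_auts (Gamma n)"
    proof
      show "affine ` (V \<times> carrier H) \<subseteq> graph_auts (Gamma n)" using affine_aut by blast
      show "graph_auts (Gamma n) \<subseteq> affine ` (V \<times> carrier H)"
      proof
        fix f assume "f \<in> graph_auts (Gamma n)"
        then interpret cyclic_latin_square_aut n f by unfold_locales
        show "f \<in> affine ` (V \<times> carrier H)" using f_affine by blast
      qed
    qed
    ultimately show "bij_betw affine (carrier ?S) (carrier (graph_aut_group (Gamma n)))"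
      unfolding S A bij_betw_def by blast
  qed
  ultimately show ?thesis
    using group.iso_sym is_isoI by blast
qed

end
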